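(* Let $\mathcal{N}\subseteq\mathbb{V}^{m\times n}$ be a nonempty open set, let $g:\mathbb{R}^m\to\mathbb{R}^m$ be absolutely symmetric on an open set $\hat\sigma_{\mathcal{N}}\subseteq\mathbb{R}^m$ containing $\{\sigma(X)\mid X\in\mathcal{N}\}$, and let $G:\mathcal{N}\to\mathbb{V}^{m\times n}$ be the spectral operator with respect to $g$. Let $\overline{X}\in\mathcal{N}$. Then $G$ is continuously differentiable at $\overline{X}$ if and only if $g$ is continuously differentiable at $\overline\sigma=\sigma(\overline{X})$.
   Context: Fix $m\le n$. $\mathbb{V}^{m\times n}$ denotes either $\mathbb{R}^{m\times n}$ or $\mathbb{C}^{m\times n}$, viewed as a real Euclidean space with inner product $\langle X,Y\rangle=\mathrm{Re}(\mathrm{trace}(X^{*}Y))$, where $X^{*}$ is the (conjugate) transpose; differentiability is over $\mathbb{R}$. $\mathbb{O}^p$ is the set of $p\times p$ orthogonal (real case) or unitary (complex case) matrices. $\sigma(Z)\in\mathbb{R}^m$ is the vector of singular values $\sigma_1(Z)\ge\cdots\ge\sigma_m(Z)\ge0$ of $Z\in\mathbb{V}^{m\times n}$; $\mathrm{Diag}(x)$ is the diagonal matrix with diagonal $x$; $\mathbb{O}^{m,n}(Z)$ is the set of pairs $(U,V)\in\mathbb{O}^m\times\mathbb{O}^n$ with $Z=U[\mathrm{Diag}(\sigma(Z))\quad 0]V^{*}$. A signed permutation matrix is a square matrix with exactly one nonzero entry in each row and each column, that entry being $\pm1$. The mapping $g:\mathbb{R}^m\to\mathbb{R}^m$ is absolutely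 symmetric on a set $D$ if $g(Qx)=Qg(x)$ for every $x\in D$ and every $m\times m$ signed permutation matrix $Q$. The spectral operator $G$ with respect to $g$ is $G(X)=U[\mathrm{Diag}(g(\sigma(X)))\quad 0]V^{*}$ for $X\in\mathcal{N}$, where $(U,V)\in\mathbb{O}^{m,n}(X)$ (the value does not depend on the choice of $(U,V)$). A function is continuously differentiable at a point if it is Fréchet differentiable on an open neighborhood of the point and its derivative is continuous at the point. *)

theory Defs
  imports "HOL-Analysis.Analysis" "Jordan_Normal_Form.Conjugate"
begin

text \<open>
  A matrix with rows indexed by \<open>'m\<close>, columns indexed by \<open>'n\<close> and entries in \<open>'a\<close> (real or
  complex) has type \<open>('a, 'm, 'n) matrix\<close>, i.e. \<open>'a^'n^'m\<close>.  The index types are finite and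
  linearly ordered, so that \<open>'m\<close> is identified with the positions \<open>0, \<dots>, CARD('m) - 1\<close>; every
  positive size is attained by such a type.  \<^const>\<open>conjugate\<close> is the identity on real numbers
  and \<^const>\<open>cnj\<close> on complex numbers.
\<close>

subsection \<open>Matrices over the real or complex numbers\<close>

type_synonym ('a, 'm, 'n) matrix = "(('a, 'n) vec, 'm) vec"

definition adjoint_matrix :: "'a::conjugate^'n^'m \<Rightarrow> 'a^'m^'n" where
  "adjoint_matrix A = (\<chi> i j. conjugate (A $ j $ i))"

text \<open>The norm, inner product and derivatives on matrix types are the ones of the real Euclidean
  space with inner product \<open>Re (trace (X\<^sup>* Y))\<close>:\<close>

lemma inner_matrix_real:
  fixes X Y :: "real^'n^'m"
  shows "X \<bullet> Y = trace (adjoint_matrix X ** Y)"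
  by (simp add: inner_vec_def trace_def adjoint_matrix_def matrix_matrix_mult_def)
     (rule sum.swap)

lemma inner_matrix_complex:
  fixes X Y :: "complex^'n^'m"
  shows "X \<bullet> Y = Re (trace (adjoint_matrix X ** Y))"
  by (simp add: inner_vec_def trace_def adjoint_matrix_def matrix_matrix_mult_def inner_complex_def)
     (rule sum.swap)

definition unitary_matrix :: "'a::{real_field,conjugate}^'p^'p \<Rightarrow> bool" where
  "unitary_matrix U \<longleftrightarrow> adjoint_matrix U ** U = mat 1 \<and> U ** adjoint_matrix U = mat 1"

lemma unitary_matrix_real: "unitary_matrix (U :: real^'p^'p) \<longleftrightarrow> orthogonal_matrix U"
  by (simp add: unitary_matrix_def orthogonal_matrix_def adjoint_matrix_def transpose_def)

subsection \<open>Singular values and singular value decompositions\<close>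

definition position :: "'i::{finite,linorder} \<Rightarrow> nat" where
  "position i = card {..<i}"

text \<open>\<open>diag_zero x\<close> is the \<open>m \<times> n\<close> block matrix \<open>[Diag(x) 0]\<close> (for \<open>m \<le> n\<close>).\<close>

definition diag_zero ::
  "(real, 'm::{finite,linorder}) vec \<Rightarrow> ('a::real_field, 'm, 'n::{finite,linorder}) matrix" where
  "diag_zero x = (\<chi> i j. if position i = position j then of_real (x $ i) else 0)"

text \<open>The singular values of \<open>Z\<close> are the nonnegative square roots of the \<open>m\<close> eigenvalues of
  \<open>Z Z\<^sup>*\<close>, counted with multiplicity (hence the characteristic polynomial) and listed in
  nonincreasing order.\<close>

definition singular_values ::
  "('a::{real_field,conjugate}, 'm::{finite,linorder}, 'n::finite) matrix \<Rightarrow> (real, 'm) vec" where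
  "singular_values Z = (THE s.
     (\<forall>i. 0 \<le> s $ i) \<and> (\<forall>i j. i \<le> j \<longrightarrow> s $ j \<le> s $ i) \<and>
     (\<forall>t. det (mat t - Z ** adjoint_matrix Z) = (\<Prod>i\<in>UNIV. t - of_real ((s $ i)\<^sup>2))))"

definition svd_pairs ::
  "('a::{real_field,conjugate}, 'm::{finite,linorder}, 'n::{finite,linorder}) matrix \<Rightarrow>
     (('a, 'm, 'm) matrix \<times> ('a, 'n, 'n) matrix) set" where
  "svd_pairs Z = {(U, V). unitary_matrix U \<and> unitary_matrix V \<and>
     Z = U ** diag_zero (singular_values Z) ** adjoint_matrix V}"

subsection \<open>Absolutely symmetric mappings and spectral operators\<close>

definition signed_permutation_matrix :: "real^'m^'m \<Rightarrow> bool" where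
  "signed_permutation_matrix Q \<longleftrightarrow>
     (\<forall>i. \<exists>!j. Q $ i $ j \<noteq> 0) \<and> (\<forall>j. \<exists>!i. Q $ i $ j \<noteq> 0) \<and>
     (\<forall>i j. Q $ i $ j \<noteq> 0 \<longrightarrow> Q $ i $ j = 1 \<or> Q $ i $ j = -1)"

definition absolutely_symmetric_on :: "(real^'m) set \<Rightarrow> (real^'m \<Rightarrow> real^'m) \<Rightarrow> bool" where
  "absolutely_symmetric_on D g \<longleftrightarrow>
     (\<forall>x\<in>D. \<forall>Q. signed_permutation_matrix Q \<longrightarrow> g (Q *v x) = Q *v g x)"

text \<open>When \<open>g\<close> is absolutely symmetric on a set containing the singular value vectors of the
  elements of \<open>N\<close>, the value prescribed for \<open>G X\<close> does not depend on the pair \<open>(U, V)\<close>.  The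
  values of \<open>G\<close> outside \<open>N\<close> are arbitrary.\<close>

definition spectral_operator_on ::
  "('a::{real_field,conjugate}, 'm::{finite,linorder}, 'n::{finite,linorder}) matrix set \<Rightarrow>
     ((real, 'm) vec \<Rightarrow> (real, 'm) vec) \<Rightarrow>
     (('a, 'm, 'n) matrix \<Rightarrow> ('a, 'm, 'n) matrix) \<Rightarrow> bool" where
  "spectral_operator_on N g G \<longleftrightarrow>
     (\<forall>X\<in>N. \<exists>(U, V)\<in>svd_pairs X.
        G X = U ** diag_zero (g (singular_values X)) ** adjoint_matrix V)"

subsection \<open>Continuous differentiability at a point\<close>

definition continuously_differentiable_at ::
  "('a::real_normed_vector \<Rightarrow> 'b::real_normed_vector) \<Rightarrow> 'a \<Rightarrow> bool" where
  "continuously_differentiable_at f x \<longleftrightarrow>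
     (\<exists>W (f' :: 'a \<Rightarrow> 'a \<Rightarrow>\<^sub>L 'b). open W \<and> x \<in> W \<and>
        (\<forall>y\<in>W. (f has_derivative blinfun_apply (f' y)) (at y)) \<and> isCont f' x)"

end

theory Submission
  imports Defs
begin

text \<open>
  The theorem comes from one comparison principle for matrices
  \<open>Y = U [Diag(y) 0] V\<^sup>*\<close> and \<open>Z = U' [Diag(z) 0] V'\<^sup>*\<close>.  For fixed unitary factors the inner
  product of \<open>Y\<close> and \<open>Z\<close> equals \<open>y \<bullet> (S *v z)\<close>, where the real matrix \<open>S\<close> depends only on the
  unitary factors and has absolute row and column sums at most 1.  By a signed version of
  Birkhoff's theorem, \<open>S\<close> is a convex combination of signed permutation matrices.  Therefore
  \<open>(norm (Y - Z))\<^sup>2\<close> is a weighted mean of the numbers \<open>(norm (y - Q *v z))\<^sup>2\<close>, and the same weights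
  serve for every other pair of vectors put in place of \<open>y\<close> and \<open>z\<close>.  Three facts follow at once:
  singular values are 1-Lipschitz up to a signed permutation, the value of a spectral operator is
  the same for all decompositions, and a bound \<open>norm (a - Q *v b) \<le> K * norm (y - Q *v z)\<close> valid
  for all \<open>Q\<close> passes to the matrices built from \<open>a\<close>, \<open>b\<close>, \<open>y\<close>, \<open>z\<close> (\<open>norm_diff_sv_matrix_le\<close>).

  If \<open>G\<close> is continuously differentiable at \<open>X = U [Diag(\<sigma>) 0] V\<^sup>*\<close>, so is \<open>g\<close> at \<open>\<sigma>\<close>, because on the
  isometrically embedded slice of all matrices \<open>U [Diag(x) 0] V\<^sup>*\<close> the operator \<open>G\<close> is \<open>g\<close>.

  For the converse let \<open>g\<close> be differentiable at \<open>\<sigma>\<close>.  There is a polynomial, absolutely symmetric map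
  \<open>p\<close> with the value and the derivative of \<open>g\<close> at \<open>\<sigma>\<close> whose spectral operator \<open>P\<close> is a polynomial in
  the entries of \<open>X\<close> and their conjugates, hence smooth (\<open>exists_smooth_lift_jet\<close>).  The difference
  \<open>h = g - p\<close> is \<open>o(norm (x - \<sigma>))\<close>, so by the Lipschitz property of singular values \<open>G - P\<close> is
  \<open>o(norm (Y - X))\<close>.  Thus \<open>G\<close> is differentiable wherever \<open>g\<close> is differentiable at the singular
  values.  If moreover the derivative of \<open>g\<close> is continuous at \<open>\<sigma>\<close>, then \<open>h\<close> has arbitrarily small
  Lipschitz constants near the orbit of \<open>\<sigma>\<close> under signed permutations; by the comparison principle
  \<open>G - P\<close> has the same small Lipschitz constants near \<open>X\<close>, and its derivative tends to 0 at \<open>X\<close>.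
\<close>

section \<open>Scalars and unitary matrices\<close>

text \<open>
  This class treats the real and the complex case together: its one axiom says that multiplication
  by \<open>conjugate x\<close> is the adjoint of multiplication by \<open>x\<close> for the real inner product.
\<close>

class real_or_complex = real_normed_field + conjugatable_ring + euclidean_space +
  assumes inner_mult_left: "inner (x * y) z = inner y (conjugate x * z)"

instance real :: real_or_complex
  by standard simp

instance complex :: real_or_complex
  by standard (auto simp: inner_complex_def algebra_simps)

lemma inner_of_real_mult: "inner (of_real a) (x :: 'a::real_or_complex) = a * inner 1 x"
  by (metis inner_scaleR_left of_real_def)

lemma inner_self_conjugate: "inner (x :: 'a::real_or_complex) x = inner 1 (x * conjugate x)"
  by (metis inner_mult_left mult.commute mult_1_right)

lemma norm_conjugate: "norm (conjugate x :: 'a::real_or_complex) = norm x"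
  by (simp add: norm_eq_sqrt_inner inner_self_conjugate mult.commute)

lemma adjoint_matrix_mult:
  fixes A :: "'a::real_or_complex^'n^'m" and B :: "'a^'p^'n"
  shows "adjoint_matrix (A ** B) = adjoint_matrix B ** adjoint_matrix A"
  by (simp add: adjoint_matrix_def matrix_matrix_mult_def sum_conjugate conjugate_dist_mul
      vec_eq_iff mult.commute)

lemma adjoint_adjoint [simp]: "adjoint_matrix (adjoint_matrix A) = (A :: 'a::real_or_complex^'n^'m)"
  by (simp add: adjoint_matrix_def vec_eq_iff)

text \<open>
  The matrix form of the class axiom: multiplication by \<open>A\<close> from the left has multiplication by the
  conjugate transpose as adjoint, and likewise from the right.
\<close>

lemma inner_matrix_mult_left:
  fixes A :: "'a::real_or_complex^'n^'m" and B :: "'a^'p^'n"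
  shows "(A ** B) \<bullet> C = B \<bullet> (adjoint_matrix A ** C)"
proof -
  have "(A ** B) \<bullet> C = (\<Sum>i\<in>UNIV. \<Sum>j\<in>UNIV. \<Sum>k\<in>UNIV. B $ k $ j \<bullet> (conjugate (A $ i $ k) * C $ i $ j))"
    by (simp add: inner_vec_def matrix_matrix_mult_def inner_sum_left inner_mult_left)
  also have "\<dots> = (\<Sum>k\<in>UNIV. \<Sum>j\<in>UNIV. \<Sum>i\<in>UNIV. B $ k $ j \<bullet> (conjugate (A $ i $ k) * C $ i $ j))"
    by (subst sum.swap, subst (2) sum.swap, subst sum.swap, rule refl)
  finally show ?thesis
    by (simp add: inner_vec_def matrix_matrix_mult_def inner_sum_right adjoint_matrix_def)
qed

lemma inner_matrix_mult_right:
  fixes A :: "'a::real_or_complex^'n^'m" and B :: "'a^'p^'n"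
  shows "(A ** B) \<bullet> C = A \<bullet> (C ** adjoint_matrix B)"
proof -
  have "(A ** B) \<bullet> C = (\<Sum>i\<in>UNIV. \<Sum>j\<in>UNIV. \<Sum>k\<in>UNIV. A $ i $ k \<bullet> (C $ i $ j * conjugate (B $ k $ j)))"
    by (simp add: inner_vec_def matrix_matrix_mult_def inner_sum_left mult.commute
        inner_mult_left[of "_ $ _ $ _", simplified mult.commute])
  also have "\<dots> = (\<Sum>i\<in>UNIV. \<Sum>k\<in>UNIV. \<Sum>j\<in>UNIV. A $ i $ k \<bullet> (C $ i $ j * conjugate (B $ k $ j)))"
    by (intro sum.cong refl sum.swap)
  finally show ?thesis
    by (simp add: inner_vec_def matrix_matrix_mult_def inner_sum_right adjoint_matrix_def)
qed

lemma unitary_matrix_adjoint: "unitary_matrix U \<Longrightarrow> unitary_matrix (adjoint_matrix (U :: 'a::real_or_complex^'n^'n))"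
  by (simp add: unitary_matrix_def)

lemma unitary_matrix_mult:
  assumes "unitary_matrix U" "unitary_matrix (V :: 'a::real_or_complex^'n^'n)"
  shows "unitary_matrix (U ** V)"
proof -
  have "adjoint_matrix V ** adjoint_matrix U ** (U ** V) = adjoint_matrix V ** (adjoint_matrix U ** U) ** V"
    "U ** V ** (adjoint_matrix V ** adjoint_matrix U) = U ** (V ** adjoint_matrix V) ** adjoint_matrix U"
    by (simp_all add: matrix_mul_assoc)
  then show ?thesis
    using assms by (simp add: unitary_matrix_def adjoint_matrix_mult)
qed

lemma sum_norm_row_unitary:
  fixes U :: "'a::real_or_complex^'n^'n"
  assumes "unitary_matrix U"
  shows "(\<Sum>j\<in>UNIV. (norm (U $ i $ j))\<^sup>2) = 1"
proof -
  have "(\<Sum>j\<in>UNIV. (norm (U $ i $ j))\<^sup>2) = 1 \<bullet> (U ** adjoint_matrix U) $ i $ i"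
    by (simp add: power2_norm_eq_inner inner_self_conjugate matrix_matrix_mult_def
        inner_sum_right adjoint_matrix_def)
  also have "\<dots> = (norm (1::'a))\<^sup>2"
    using assms by (simp add: unitary_matrix_def mat_def power2_norm_eq_inner del: norm_one)
  finally show ?thesis by simp
qed

lemma sum_norm_column_unitary:
  fixes U :: "'a::real_or_complex^'n^'n"
  assumes "unitary_matrix U"
  shows "(\<Sum>i\<in>UNIV. (norm (U $ i $ j))\<^sup>2) = 1"
  using sum_norm_row_unitary[OF unitary_matrix_adjoint[OF assms], of j]
  by (simp add: adjoint_matrix_def norm_conjugate)

section \<open>A signed Birkhoff theorem\<close>

text \<open>
  These matrices form the polytope whose vertices turn out to be the signed permutation matrices.
\<close>

definition abs_doubly_substochastic :: "real^'m^'m \<Rightarrow> bool" where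
  "abs_doubly_substochastic S \<longleftrightarrow>
     (\<forall>i. (\<Sum>j\<in>UNIV. \<bar>S $ i $ j\<bar>) \<le> 1) \<and> (\<forall>j. (\<Sum>i\<in>UNIV. \<bar>S $ i $ j\<bar>) \<le> 1)"

lemma convex_abs_doubly_substochastic: "convex {S :: real^'m^'m. abs_doubly_substochastic S}"
proof (rule convexI, goal_cases)
  case (1 A B u v)
  have tri: "\<bar>(u *\<^sub>R A + v *\<^sub>R B) $ i $ j\<bar> \<le> u * \<bar>A $ i $ j\<bar> + v * \<bar>B $ i $ j\<bar>" for i j
    using abs_triangle_ineq[of "u * A $ i $ j" "v * B $ i $ j"] 1 by (simp add: abs_mult)
  have bnd: "u * a + v * b \<le> 1" if "a \<le> 1" "b \<le> 1" for a b
    using 1 that convex_bound_le by blast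
  have "(\<Sum>j\<in>UNIV. \<bar>(u *\<^sub>R A + v *\<^sub>R B) $ i $ j\<bar>)
      \<le> u * (\<Sum>j\<in>UNIV. \<bar>A $ i $ j\<bar>) + v * (\<Sum>j\<in>UNIV. \<bar>B $ i $ j\<bar>)" for i
    unfolding sum_distrib_left sum.distrib[symmetric] by (rule sum_mono[OF tri])
  moreover have "(\<Sum>i\<in>UNIV. \<bar>(u *\<^sub>R A + v *\<^sub>R B) $ i $ j\<bar>)
      \<le> u * (\<Sum>i\<in>UNIV. \<bar>A $ i $ j\<bar>) + v * (\<Sum>i\<in>UNIV. \<bar>B $ i $ j\<bar>)" for j
    unfolding sum_distrib_left sum.distrib[symmetric] by (rule sum_mono[OF tri])
  ultimately show ?case
    using 1 bnd unfolding abs_doubly_substochastic_def mem_Collect_eq by (meson order_trans)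
qed

lemma compact_abs_doubly_substochastic: "compact {S :: real^'m^'m. abs_doubly_substochastic S}"
proof -
  have "closed {S :: real^'m^'m. abs_doubly_substochastic S}"
    unfolding abs_doubly_substochastic_def
    by (intro closed_Collect_conj closed_Collect_all closed_Collect_le continuous_intros)
  moreover have "norm S \<le> real CARD('m)" if "abs_doubly_substochastic S" for S :: "real^'m^'m"
  proof -
    have "norm S \<le> (\<Sum>i\<in>UNIV. norm (S $ i))"
      by (simp add: norm_vec_def L2_set_le_sum)
    also have "\<dots> \<le> (\<Sum>i\<in>UNIV. \<Sum>j\<in>UNIV. \<bar>S $ i $ j\<bar>)"
      by (intro sum_mono norm_le_l1_cart)
    also have "\<dots> \<le> (\<Sum>i\<in>(UNIV::'m set). 1)"
      using that by (intro sum_mono) (simp add: abs_doubly_substochastic_def)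
    finally show ?thesis by simp
  qed
  ultimately show ?thesis
    unfolding compact_eq_bounded_closed bounded_iff by blast
qed

lemma not_extreme_point_if_midpoint:
  fixes S :: "'a::real_normed_vector"
  assumes "S + T \<in> A" "S - T \<in> A" "T \<noteq> 0"
  shows "\<not> S extreme_point_of A"
proof -
  have "S + T \<noteq> S - T"
  proof
    assume "S + T = S - T"
    then have "T + T = 0" by (simp add: algebra_simps)
    then have "2 *\<^sub>R T = 0" by (simp add: scaleR_2)
    then show False using assms(3) by simp
  qed
  then have "midpoint (S + T) (S - T) \<in> open_segment (S + T) (S - T)"
    by simp
  moreover have "midpoint (S + T) (S - T) = S"
    by (simp add: midpoint_def scaleR_2[symmetric])
  ultimately show ?thesis
    using assms unfolding extreme_point_of_def by metis
qed

text \<open>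
  If a row sum of \<open>S\<close> is less than 1, then so is a column sum, because both families have the same
  total.  The entry at their intersection can then be moved in both directions inside the polytope,
  so \<open>S\<close> is not extreme.
\<close>

lemma extreme_point_sums_eq_1:
  fixes S :: "real^'m^'m"
  assumes ext: "S extreme_point_of {S. abs_doubly_substochastic S}"
  shows "(\<Sum>j\<in>UNIV. \<bar>S $ i $ j\<bar>) = 1" and "(\<Sum>i\<in>UNIV. \<bar>S $ i $ j\<bar>) = 1"
proof -
  define r c where "r i = (\<Sum>j\<in>UNIV. \<bar>S $ i $ j\<bar>)" and "c j = (\<Sum>i\<in>UNIV. \<bar>S $ i $ j\<bar>)" for i j
  have S: "r i \<le> 1" "c j \<le> 1" for i j
    using ext by (auto simp: extreme_point_of_def abs_doubly_substochastic_def r_def c_def)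
  have rc: "sum r UNIV = sum c UNIV"
    unfolding r_def c_def by (rule sum.swap)
  have no: "\<not> (r i < 1 \<and> c j < 1)" for i j
  proof
    assume *: "r i < 1 \<and> c j < 1"
    define t where "t = min (1 - r i) (1 - c j)"
    have t: "t > 0" "r i + t \<le> 1" "c j + t \<le> 1" using * by (auto simp: t_def)
    define T :: "real^'m^'m" where "T = (\<chi> k l. if k = i \<and> l = j then t else 0)"
    have "abs_doubly_substochastic (S + e *\<^sub>R T)" if "\<bar>e\<bar> = 1" for e
    proof -
      have le: "\<bar>(S + e *\<^sub>R T) $ k $ l\<bar> \<le> \<bar>S $ k $ l\<bar> + (if k = i \<and> l = j then t else 0)" for k l
        using t abs_triangle_ineq[of "S $ k $ l" "e * T $ k $ l"] that by (auto simp: T_def abs_mult)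
      have "(\<Sum>l\<in>UNIV. \<bar>(S + e *\<^sub>R T) $ k $ l\<bar>) \<le> 1" for k
      proof -
        have "(\<Sum>l\<in>UNIV. \<bar>(S + e *\<^sub>R T) $ k $ l\<bar>)
            \<le> (\<Sum>l\<in>UNIV. \<bar>S $ k $ l\<bar> + (if k = i \<and> l = j then t else 0))"
          by (rule sum_mono[OF le])
        also have "\<dots> = r k + (if k = i then t else 0)"
          by (simp add: sum.distrib r_def)
        also have "\<dots> \<le> 1" using S t by auto
        finally show ?thesis .
      qed
      moreover have "(\<Sum>k\<in>UNIV. \<bar>(S + e *\<^sub>R T) $ k $ l\<bar>) \<le> 1" for l
      proof -
        have "(\<Sum>k\<in>UNIV. \<bar>(S + e *\<^sub>R T) $ k $ l\<bar>)
            \<le> (\<Sum>k\<in>UNIV. \<bar>S $ k $ l\<bar> + (if k = i \<and> l = j then t else 0))"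
          by (rule sum_mono[OF le])
        also have "\<dots> = c l + (if l = j then t else 0)"
          by (cases "l = j") (simp_all add: sum.distrib c_def)
        also have "\<dots> \<le> 1" using S t by auto
        finally show ?thesis .
      qed
      ultimately show ?thesis by (simp add: abs_doubly_substochastic_def)
    qed
    from this[of 1] this[of "-1"]
    have "S + T \<in> {S. abs_doubly_substochastic S}" "S - T \<in> {S. abs_doubly_substochastic S}"
      by simp_all
    moreover have "T $ i $ j \<noteq> 0"
      using t by (simp add: T_def)
    then have "T \<noteq> 0" by auto
    ultimately show False
      using not_extreme_point_if_midpoint[of S T] ext by metis
  qed
  have "r i = 1" for i
  proof (rule ccontr)
    assume "r i \<noteq> 1"
    then have *: "r i < 1" using S(1)[of i] by simp
    then have c1: "c j = 1" for j using no[of i j] S(2)[of j] by force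
    have "sum r UNIV < (\<Sum>i\<in>(UNIV::'m set). 1)"
      using * S by (intro sum_strict_mono_ex1) auto
    moreover have "sum c UNIV = (\<Sum>i\<in>(UNIV::'m set). 1)" by (simp add: c1)
    ultimately show False using rc by simp
  qed
  note r1 = this
  have "c j = 1" for j
  proof (rule ccontr)
    assume "c j \<noteq> 1"
    then have *: "c j < 1" using S(2)[of j] by simp
    have "sum c UNIV < (\<Sum>i\<in>(UNIV::'m set). 1)"
      using * S by (intro sum_strict_mono_ex1) auto
    moreover have "sum r UNIV = (\<Sum>i\<in>(UNIV::'m set). 1)" by (simp add: r1)
    ultimately show False using rc by simp
  qed
  with r1 show "(\<Sum>j\<in>UNIV. \<bar>S $ i $ j\<bar>) = 1" and "(\<Sum>i\<in>UNIV. \<bar>S $ i $ j\<bar>) = 1"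
    by (auto simp: r_def c_def)
qed

lemma exists_other_fractional:
  fixes x :: "'m::finite \<Rightarrow> real"
  assumes "(\<Sum>j\<in>UNIV. \<bar>x j\<bar>) = 1" "0 < \<bar>x j\<bar>" "\<bar>x j\<bar> < 1"
  shows "\<exists>k. k \<noteq> j \<and> 0 < \<bar>x k\<bar> \<and> \<bar>x k\<bar> < 1"
proof -
  have eq: "\<bar>x j\<bar> + (\<Sum>k\<in>UNIV - {j}. \<bar>x k\<bar>) = 1"
    using assms(1) by (simp add: sum.remove[of UNIV j])
  then obtain k where k: "k \<noteq> j" "\<bar>x k\<bar> \<noteq> 0"
    using assms(3) by (metis DiffD2 add.right_neutral less_irrefl singletonI sum.neutral)
  have "\<bar>x k\<bar> \<le> (\<Sum>k\<in>UNIV - {j}. \<bar>x k\<bar>)"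
    using k by (intro member_le_sum) auto
  with eq assms k show ?thesis by (intro exI[of _ k]) auto
qed

text \<open>
  A walk that alternates between changing the row within a column and changing the column within
  the row must revisit a row.  Along a shortest closed stretch of it, put \<open>+1\<close> on the entries where
  the walk leaves a row and \<open>-1\<close> on the entries where it enters one: each step contributes \<open>+1\<close> and
  \<open>-1\<close> to the same column, and the row contributions telescope.
\<close>

lemma exists_alternating_cycle:
  fixes P :: "'m::finite \<Rightarrow> 'm \<Rightarrow> bool"
  assumes row: "\<And>i j. P i j \<Longrightarrow> \<exists>k. k \<noteq> j \<and> P i k"
    and col: "\<And>i j. P i j \<Longrightarrow> \<exists>k. k \<noteq> i \<and> P k j"
    and "P i0 j0"
  shows "\<exists>T :: 'm \<Rightarrow> 'm \<Rightarrow> real. (\<exists>i j. T i j \<noteq> 0) \<and> (\<forall>i j. T i j \<noteq> 0 \<longrightarrow> P i j) \<and>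
    (\<forall>i. (\<Sum>j\<in>UNIV. T i j) = 0) \<and> (\<forall>j. (\<Sum>i\<in>UNIV. T i j) = 0)"
proof -
  have "\<exists>q. P (fst q) (snd q) \<and> P (fst q) (snd p) \<and> fst q \<noteq> fst p \<and> snd q \<noteq> snd p"
    if p: "P (fst p) (snd p)" for p
  proof -
    obtain i where i: "i \<noteq> fst p" "P i (snd p)" using col[OF p] by blast
    obtain j where "j \<noteq> snd p" "P i j" using row[OF i(2)] by blast
    with i show ?thesis by (intro exI[of _ "(i, j)"]) auto
  qed
  then obtain f where f: "\<And>p. P (fst p) (snd p) \<Longrightarrow> P (fst (f p)) (snd (f p)) \<and> P (fst (f p)) (snd p)
      \<and> fst (f p) \<noteq> fst p \<and> snd (f p) \<noteq> snd p"
    by metis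
  define i j where "i n = fst ((f ^^ n) (i0, j0))" and "j n = snd ((f ^^ n) (i0, j0))" for n
  have P: "P (i n) (j n)" for n
    by (induction n) (use assms f in \<open>auto simp: i_def j_def\<close>)
  have step: "P (i (Suc n)) (j n)" "i (Suc n) \<noteq> i n" "j (Suc n) \<noteq> j n" for n
    using f[of "(f ^^ n) (i0, j0)"] P[of n] by (auto simp: i_def j_def)
  define R where "R d \<longleftrightarrow> 0 < d \<and> (\<exists>p. i p = i (p + d))" for d
  have "\<exists>d. R d"
  proof -
    have "\<not> inj i"
      using finite_imageD[of i UNIV] by auto
    then obtain x y where xy: "i x = i y" "x < y"
      by (metis injI linorder_neqE_nat)
    then have "R (y - x)" unfolding R_def by (intro conjI exI[of _ x]) auto
    then show ?thesis ..
  qed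
  then have least: "R (LEAST d. R d)" by (rule LeastI_ex)
  define d where "d = (LEAST d. R d)"
  from least obtain p where d: "0 < d" and p: "i p = i (p + d)"
    unfolding R_def d_def by blast
  have dist: "i x \<noteq> i y" if "x < y" "y - x < d" for x y
  proof
    assume "i x = i y"
    with that(1) have "R (y - x)" unfolding R_def by (intro conjI exI[of _ x]) auto
    then show False using that(2) not_less_Least unfolding d_def by blast
  qed
  have "d \<noteq> 1" using p step(2)[of p] by auto
  with d have d2: "2 \<le> d" by simp
  define T :: "'m \<Rightarrow> 'm \<Rightarrow> real" where "T r c = (\<Sum>k\<in>{p..<p + d}.
      of_bool (r = i k \<and> c = j k) - of_bool (r = i (Suc k) \<and> c = j k))" for r c
  \<comment> \<open>The entry at which the walk enters its second row receives no other contribution,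
    because the stretch is a shortest one.\<close>
  have "T (i (Suc p)) (j p) = (\<Sum>k\<in>{p..<p + d}. if k = p then - 1 else 0)"
    unfolding T_def
  proof (rule sum.cong[OF refl])
    fix k assume k: "k \<in> {p..<p + d}"
    consider "k = p" | "k = Suc p" | "Suc p < k" using k by fastforce
    then show "of_bool (i (Suc p) = i k \<and> j p = j k) - of_bool (i (Suc p) = i (Suc k) \<and> j p = j k)
        = (if k = p then - 1 else (0::real))"
    proof cases
      case 1 then show ?thesis using step(2)[of p] by auto
    next
      case 2 then show ?thesis using step(3)[of p] by auto
    next
      case 3
      then have "i (Suc p) \<noteq> i k" "i (Suc p) \<noteq> i (Suc k)"
        using k by (intro dist; simp)+
      with 3 show ?thesis by simp
    qed
  qed
  also have "\<dots> = - 1" using d by simp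
  finally have "T (i (Suc p)) (j p) \<noteq> 0" by simp
  moreover have "P r c" if "T r c \<noteq> 0" for r c
  proof -
    have "\<exists>k. c = j k \<and> (r = i k \<or> r = i (Suc k))"
    proof (rule ccontr)
      assume "\<not> ?thesis"
      then have "T r c = 0"
        unfolding T_def by (intro sum.neutral) auto
      with that show False by simp
    qed
    then show ?thesis using P step(1) by auto
  qed
  moreover have "(\<Sum>c\<in>UNIV. T r c) = 0" for r
  proof -
    have "(\<Sum>c\<in>UNIV. T r c) = (\<Sum>k\<in>{p..<p + d}. of_bool (r = i k) - of_bool (r = i (Suc k)))"
      unfolding T_def
      by (subst sum.swap) (simp add: sum_subtractf of_bool_conj flip: sum_distrib_left)
    also have "\<dots> = of_bool (r = i p) - of_bool (r = i (p + d))"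
      using sum_Suc_diff'[of p "p + d" "\<lambda>k. - of_bool (r = i k)"] by simp
    finally show ?thesis using p by simp
  qed
  moreover have "(\<Sum>r\<in>UNIV. T r c) = 0" for c
    unfolding T_def
    by (subst sum.swap) (rule sum.neutral, simp add: sum_subtractf of_bool_conj flip: sum_distrib_right)
  ultimately show ?thesis by (intro exI[of _ T]) blast
qed

text \<open>
  Entries with absolute value strictly between 0 and 1 never stand alone in a row or column with
  absolute sum 1, so an alternating cycle runs through them.  Adding and subtracting a small
  multiple of it, with the signs of \<open>S\<close>, keeps all absolute row and column sums.
\<close>

lemma extreme_point_not_fractional:
  fixes S :: "real^'m^'m"
  assumes ext: "S extreme_point_of {S. abs_doubly_substochastic S}"
  shows "\<not> (0 < \<bar>S $ i $ j\<bar> \<and> \<bar>S $ i $ j\<bar> < 1)"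
proof
  define P where "P i j \<longleftrightarrow> 0 < \<bar>S $ i $ j\<bar> \<and> \<bar>S $ i $ j\<bar> < 1" for i j
  note S = extreme_point_sums_eq_1[OF ext]
  assume "0 < \<bar>S $ i $ j\<bar> \<and> \<bar>S $ i $ j\<bar> < 1"
  then have "P i j" by (simp add: P_def)
  moreover have "\<exists>k. k \<noteq> j \<and> P i k" if "P i j" for i j
    using exists_other_fractional[of "\<lambda>j. S $ i $ j" j] S(1) that by (simp add: P_def)
  moreover have "\<exists>k. k \<noteq> i \<and> P k j" if "P i j" for i j
    using exists_other_fractional[of "\<lambda>i. S $ i $ j" i] S(2) that by (simp add: P_def)
  ultimately have "\<exists>T :: 'm \<Rightarrow> 'm \<Rightarrow> real. (\<exists>i j. T i j \<noteq> 0) \<and> (\<forall>i j. T i j \<noteq> 0 \<longrightarrow> P i j) \<and>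
    (\<forall>i. (\<Sum>j\<in>UNIV. T i j) = 0) \<and> (\<forall>j. (\<Sum>i\<in>UNIV. T i j) = 0)"
    by (rule exists_alternating_cycle[rotated 2])
  then obtain T :: "'m \<Rightarrow> 'm \<Rightarrow> real" and a b where ab: "T a b \<noteq> 0" and T: "\<And>i j. T i j \<noteq> 0 \<Longrightarrow> P i j"
    and T0: "\<And>i. (\<Sum>j\<in>UNIV. T i j) = 0" "\<And>j. (\<Sum>i\<in>UNIV. T i j) = 0"
    by blast
  define A where "A = (\<lambda>(i, j). if T i j = 0 then 1 else \<bar>S $ i $ j\<bar> / \<bar>T i j\<bar>) ` UNIV"
  define t where "t = Min A"
  have fin: "finite A" unfolding A_def by simp
  have "t \<in> A" unfolding t_def by (rule Min_in[OF fin]) (simp add: A_def)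
  then have t0: "t > 0" using T by (auto simp: A_def P_def)
  have tT: "\<bar>t * T k l\<bar> \<le> \<bar>S $ k $ l\<bar>" for k l
  proof (cases "T k l = 0")
    case False
    have "t \<le> \<bar>S $ k $ l\<bar> / \<bar>T k l\<bar>"
      unfolding t_def by (rule Min_le[OF fin]) (use False in \<open>auto simp: A_def intro!: image_eqI[of _ _ "(k, l)"]\<close>)
    then show ?thesis using False t0 by (simp add: abs_mult field_simps)
  qed simp
  define E :: "real^'m^'m" where "E = (\<chi> k l. sgn (S $ k $ l) * (t * T k l))"
  have "abs_doubly_substochastic (S + e *\<^sub>R E)" if "\<bar>e\<bar> = 1" for e
  proof -
    have "\<bar>(S + e *\<^sub>R E) $ k $ l\<bar> = \<bar>S $ k $ l\<bar> + e * (t * T k l)" for k l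
    proof -
      have "e = 1 \<or> e = -1" using that by linarith
      then show ?thesis
        using tT[of k l] by (cases "S $ k $ l" "0::real" rule: linorder_cases) (auto simp: E_def)
    qed
    then show ?thesis
      by (simp add: abs_doubly_substochastic_def sum.distrib S T0 flip: sum_distrib_left)
  qed
  from this[of 1] this[of "-1"]
  have "S + E \<in> {S. abs_doubly_substochastic S}" "S - E \<in> {S. abs_doubly_substochastic S}"
    by simp_all
  moreover have "E $ a $ b \<noteq> 0"
    using t0 ab T[OF ab] by (auto simp: E_def P_def sgn_if)
  then have "E \<noteq> 0" by auto
  ultimately show False
    using not_extreme_point_if_midpoint[of S E] ext by metis
qed

lemma unique_nonzero_if_sum_eq_1:
  fixes x :: "'m::finite \<Rightarrow> real"
  assumes "(\<Sum>j\<in>UNIV. \<bar>x j\<bar>) = 1" "\<And>j. \<bar>x j\<bar> = 0 \<or> \<bar>x j\<bar> = 1"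
  shows "\<exists>!j. x j \<noteq> 0"
proof -
  have "1 = (\<Sum>j\<in>UNIV. \<bar>x j\<bar>)" using assms(1) by simp
  also have "\<dots> = (\<Sum>j\<in>UNIV. if x j \<noteq> 0 then 1 else 0)"
  proof (rule sum.cong[OF refl])
    show "\<bar>x j\<bar> = (if x j \<noteq> 0 then 1 else 0)" for j
      using assms(2)[of j] by auto
  qed
  also have "\<dots> = real (card {j. x j \<noteq> 0})"
    by (simp add: sum.If_cases)
  finally have "card {j. x j \<noteq> 0} = 1" by simp
  then obtain j where "{j. x j \<noteq> 0} = {j}" by (rule card_1_singletonE)
  then show ?thesis by (metis (mono_tags) mem_Collect_eq singleton_iff)
qed

lemma extreme_point_signed_permutation_matrix:
  fixes S :: "real^'m^'m"
  assumes ext: "S extreme_point_of {S. abs_doubly_substochastic S}"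
  shows "signed_permutation_matrix S"
proof -
  note S = extreme_point_sums_eq_1[OF ext]
  have 01: "\<bar>S $ i $ j\<bar> = 0 \<or> \<bar>S $ i $ j\<bar> = 1" for i j
  proof -
    have "\<bar>S $ i $ j\<bar> \<le> (\<Sum>j\<in>UNIV. \<bar>S $ i $ j\<bar>)" by (intro member_le_sum) auto
    then show ?thesis using S(1)[of i] extreme_point_not_fractional[OF ext, of i j] by linarith
  qed
  have "\<exists>!j. S $ i $ j \<noteq> 0" for i
    using unique_nonzero_if_sum_eq_1[of "\<lambda>j. S $ i $ j"] S(1) 01 by simp
  moreover have "\<exists>!i. S $ i $ j \<noteq> 0" for j
    using unique_nonzero_if_sum_eq_1[of "\<lambda>i. S $ i $ j"] S(2) 01 by simp
  moreover have "S $ i $ j \<noteq> 0 \<longrightarrow> S $ i $ j = 1 \<or> S $ i $ j = -1" for i j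
    using 01[of i j] by linarith
  ultimately show ?thesis by (simp add: signed_permutation_matrix_def)
qed

text \<open>
  The signed Birkhoff theorem in the form in which it is used: by Krein--Milman, a linear functional
  on the polytope is bounded below by its minimum over the signed permutation matrices.
\<close>

lemma inner_ge_if_signed_permutation_matrix_inner_ge:
  fixes S K :: "real^'m^'m"
  assumes S: "abs_doubly_substochastic S"
    and Q: "\<And>Q. signed_permutation_matrix Q \<Longrightarrow> c \<le> K \<bullet> Q"
  shows "c \<le> K \<bullet> S"
proof -
  have "{S. abs_doubly_substochastic S}
      = convex hull {Q. Q extreme_point_of {S :: real^'m^'m. abs_doubly_substochastic S}}"
    by (intro Krein_Milman_Minkowski compact_abs_doubly_substochastic convex_abs_doubly_substochastic)
  also have "\<dots> \<subseteq> {S. K \<bullet> S \<ge> c}"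
    using Q extreme_point_signed_permutation_matrix
    by (intro hull_minimal convex_halfspace_ge) auto
  finally show ?thesis using S by auto
qed

section \<open>Signed permutations and rectangular diagonal matrices\<close>

text \<open>
  Every signed permutation matrix has this form, which makes its action on vectors explicit:
  coordinate \<open>i\<close> of the image is \<open>s i\<close> times coordinate \<open>\<pi> i\<close>.
\<close>

definition signed_perm :: "('m \<Rightarrow> 'm) \<Rightarrow> ('m \<Rightarrow> real) \<Rightarrow> real^'m^'m" where
  "signed_perm \<pi> s = (\<chi> i j. if j = \<pi> i then s i else 0)"

lemma signed_perm_mult_vec [simp]: "(signed_perm \<pi> s *v x) $ i = s i * x $ \<pi> i"
  by (simp add: signed_perm_def matrix_vector_mult_def if_distrib[of "\<lambda>a. a * _"] cong: if_cong)

lemma signed_permutation_matrix_iff: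
  "signed_permutation_matrix (Q :: real^'m^'m) \<longleftrightarrow>
     (\<exists>\<pi> s. bij \<pi> \<and> (\<forall>i. s i = 1 \<or> s i = -1) \<and> Q = signed_perm \<pi> s)" (is "?L \<longleftrightarrow> ?R")
proof
  assume L: ?L
  define \<pi> where "\<pi> i = (THE j. Q $ i $ j \<noteq> 0)" for i
  have \<pi>: "Q $ i $ j \<noteq> 0 \<longleftrightarrow> j = \<pi> i" for i j
    using L theI'[of "\<lambda>j. Q $ i $ j \<noteq> 0"] unfolding signed_permutation_matrix_def \<pi>_def by metis
  have "inj \<pi>"
    using L \<pi> unfolding signed_permutation_matrix_def inj_def by metis
  then have "bij \<pi>" by (simp add: finite_UNIV_inj_surj bij_def)
  moreover have "Q $ i $ \<pi> i = 1 \<or> Q $ i $ \<pi> i = -1" for i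
    using L \<pi> unfolding signed_permutation_matrix_def by metis
  moreover have "Q = signed_perm \<pi> (\<lambda>i. Q $ i $ \<pi> i)"
    using \<pi> by (auto simp: signed_perm_def vec_eq_iff)
  ultimately show ?R
    by (intro exI[of _ \<pi>] exI[of _ "\<lambda>i. Q $ i $ \<pi> i"] conjI allI)
next
  assume ?R
  then obtain \<pi> s where *: "bij \<pi>" "\<And>i. s i = 1 \<or> s i = -1" "Q = signed_perm \<pi> s"
    by (elim exE conjE) (rule that, assumption, erule spec, assumption)
  have nz: "Q $ i $ j \<noteq> 0 \<longleftrightarrow> j = \<pi> i" for i j
    using *(2)[of i] by (auto simp: *(3) signed_perm_def)
  have "\<exists>!i. j = \<pi> i" for j
    using *(1) by (metis bij_pointE)
  moreover have "Q $ i $ j \<noteq> 0 \<longrightarrow> Q $ i $ j = 1 \<or> Q $ i $ j = -1" for i j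
    using *(2)[of i] by (auto simp: *(3) signed_perm_def)
  ultimately show ?L
    unfolding signed_permutation_matrix_def nz by simp
qed

lemma signed_permutation_matrix_signed_perm:
  "bij \<pi> \<Longrightarrow> (\<And>i. s i = 1 \<or> s i = -1) \<Longrightarrow> signed_permutation_matrix (signed_perm \<pi> s)"
  unfolding signed_permutation_matrix_iff by (intro exI[of _ \<pi>] exI[of _ s] conjI allI refl)

lemma signed_permutation_matrixE:
  assumes "signed_permutation_matrix (Q :: real^'m^'m)"
  obtains \<pi> s where "bij \<pi>" "\<forall>i. s i = 1 \<or> s i = -1" "Q = signed_perm \<pi> s"
  using assms unfolding signed_permutation_matrix_iff by (elim exE conjE) (rule that)

lemma signed_permutation_matrix_one: "signed_permutation_matrix (mat 1)"
  unfolding signed_permutation_matrix_iff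
  by (rule exI[of _ id], rule exI[of _ "\<lambda>_. 1"]) (auto simp: signed_perm_def mat_def vec_eq_iff)

lemma signed_permutation_matrix_mult:
  assumes "signed_permutation_matrix Q" "signed_permutation_matrix R"
  shows "signed_permutation_matrix (Q ** R)"
proof -
  obtain \<pi> s where Q: "bij \<pi>" "\<forall>i. s i = 1 \<or> s i = -1" "Q = signed_perm \<pi> s"
    using assms(1) by (rule signed_permutation_matrixE)
  obtain \<rho> t where R: "bij \<rho>" "\<forall>i. t i = 1 \<or> t i = -1" "R = signed_perm \<rho> t"
    using assms(2) by (rule signed_permutation_matrixE)
  have "Q ** R = signed_perm (\<rho> \<circ> \<pi>) (\<lambda>i. s i * t (\<pi> i))"
    by (simp add: matrix_eq flip: matrix_vector_mul_assoc) (simp add: Q(3) R(3) vec_eq_iff)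
  moreover have "s i * t (\<pi> i) = 1 \<or> s i * t (\<pi> i) = -1" for i
    using Q(2)[rule_format, of i] R(2)[rule_format, of "\<pi> i"] by auto
  ultimately show ?thesis
    using signed_permutation_matrix_signed_perm[OF bij_comp[OF Q(1) R(1)]] by simp
qed

lemma signed_permutation_matrix_inverse:
  assumes "signed_permutation_matrix Q"
  obtains R where "signed_permutation_matrix R" "R ** Q = mat 1" "Q ** R = mat 1"
proof -
  obtain \<pi> s where Q: "bij \<pi>" "\<forall>i. s i = 1 \<or> s i = -1" "Q = signed_perm \<pi> s"
    using assms(1) by (rule signed_permutation_matrixE)
  have ss: "s i * (s i * x) = x" for i x
    using Q(2)[rule_format, of i] by auto
  define R where "R = signed_perm (inv \<pi>) (\<lambda>i. s (inv \<pi> i))"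
  have "signed_permutation_matrix R"
    unfolding R_def using Q by (intro signed_permutation_matrix_signed_perm bij_imp_bij_inv) auto
  moreover have "R ** Q = mat 1" "Q ** R = mat 1"
    using Q(1) by (simp_all add: matrix_eq R_def Q(3) vec_eq_iff ss bij_is_inj bij_is_surj surj_f_inv_f
        flip: matrix_vector_mul_assoc)
  ultimately show ?thesis using that by blast
qed

lemma norm_signed_permutation_matrix_mult:
  assumes "signed_permutation_matrix Q"
  shows "norm (Q *v x) = norm x"
proof -
  obtain \<pi> s where Q: "bij \<pi>" "\<forall>i. s i = 1 \<or> s i = -1" "Q = signed_perm \<pi> s"
    using assms(1) by (rule signed_permutation_matrixE)
  have ss: "s i * a * (s i * a) = a * a" for i a
    using Q(2)[rule_format, of i] by auto
  have "(Q *v x) \<bullet> (Q *v x) = (\<Sum>i\<in>UNIV. x $ \<pi> i * x $ \<pi> i)"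
    by (simp add: inner_vec_def Q(3) ss)
  also have "\<dots> = x \<bullet> x"
    using sum.reindex_bij_betw[OF Q(1), of "\<lambda>i. x $ i * x $ i"] by (simp add: inner_vec_def)
  finally show ?thesis by (simp add: norm_eq_sqrt_inner)
qed

lemma finite_signed_permutation_matrices: "finite {Q :: real^'m^'m. signed_permutation_matrix Q}"
proof (rule finite_subset)
  show "{Q :: real^'m^'m. signed_permutation_matrix Q}
      \<subseteq> range (\<lambda>(\<pi>, A). signed_perm \<pi> (\<lambda>i. if i \<in> A then 1 else - 1))"
  proof
    fix Q :: "real^'m^'m" assume "Q \<in> {Q. signed_permutation_matrix Q}"
    then obtain \<pi> s where Q: "\<forall>i. s i = 1 \<or> s i = -1" "Q = signed_perm \<pi> s"
      unfolding mem_Collect_eq by (rule signed_permutation_matrixE)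
    have "s = (\<lambda>i. if i \<in> {i. s i = 1} then 1 else - 1)"
      using Q(1) by (intro ext) auto
    with Q(2) have "Q = (\<lambda>(\<pi>, A). signed_perm \<pi> (\<lambda>i. if i \<in> A then 1 else - 1)) (\<pi>, {i. s i = 1})"
      by simp
    then show "Q \<in> range (\<lambda>(\<pi>, A). signed_perm \<pi> (\<lambda>i. if i \<in> A then 1 else - 1))"
      by (rule range_eqI)
  qed
qed simp

lemma strict_mono_position: "strict_mono (position :: 'i::{finite,linorder} \<Rightarrow> nat)"
  unfolding strict_mono_def position_def by (auto intro!: psubset_card_mono)

lemma range_position: "range (position :: 'i::{finite,linorder} \<Rightarrow> nat) = {..<CARD('i)}"
proof (rule card_subset_eq)
  show "range (position :: 'i \<Rightarrow> nat) \<subseteq> {..<CARD('i)}"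
    unfolding position_def by (auto intro!: psubset_card_mono)
  show "card (range (position :: 'i \<Rightarrow> nat)) = card {..<CARD('i)}"
    by (simp add: card_image strict_mono_imp_inj_on strict_mono_position)
qed simp

text \<open>
  The column of \<open>[Diag(x) 0]\<close> that contains the diagonal entry of row \<open>i\<close>; it exists when there are
  at least as many columns as rows.
\<close>

definition column_of :: "'m::{finite,linorder} \<Rightarrow> 'n::{finite,linorder}" where
  "column_of i = (SOME j. position j = position i)"

context
  assumes dims: "CARD('m::{finite,linorder}) \<le> CARD('n::{finite,linorder})"
begin

lemma position_column_of: "position (column_of (i :: 'm) :: 'n) = position i"
proof -
  have "position i \<in> range (position :: 'n \<Rightarrow> nat)"
    using rangeI[of position i] dims by (auto simp: range_position)
  then have "\<exists>j :: 'n. position j = position i" by (metis imageE)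
  then show ?thesis unfolding column_of_def by (rule someI_ex)
qed

lemma position_eq_iff: "position (i :: 'm) = position j \<longleftrightarrow> j = (column_of i :: 'n)"
  using position_column_of[of i] strict_mono_imp_inj_on[OF strict_mono_position, of UNIV]
  by (metis injD)

lemma inj_column_of: "inj (column_of :: 'm \<Rightarrow> 'n)"
  by (metis injI position_column_of position_eq_iff strict_mono_eq strict_mono_position)

lemma diag_zero_nth:
  "(diag_zero x :: ('a::real_or_complex, 'm, 'n) matrix) $ i $ j = (if j = column_of i then of_real (x $ i) else 0)"
  by (simp add: diag_zero_def position_eq_iff)

lemma inner_diag_zero:
  "(diag_zero x :: ('a::real_or_complex, 'm, 'n) matrix) \<bullet> A = (\<Sum>i\<in>UNIV. x $ i * (1 \<bullet> A $ i $ column_of i))"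
proof -
  have "(diag_zero x :: ('a, 'm, 'n) matrix) \<bullet> A
      = (\<Sum>i\<in>UNIV. \<Sum>j\<in>UNIV. if j = column_of i then of_real (x $ i) \<bullet> A $ i $ j else 0)"
    by (simp add: inner_vec_def diag_zero_nth if_distrib[of "\<lambda>a. a \<bullet> _"] cong: if_cong)
  then show ?thesis by (simp add: inner_of_real_mult)
qed

lemma diag_zero_mult_nth:
  fixes A :: "('a::real_or_complex, 'm, 'm) matrix" and B :: "('a, 'n, 'n) matrix"
  shows "(A ** diag_zero x ** B) $ i $ k = (\<Sum>j\<in>UNIV. of_real (x $ j) * (A $ i $ j * B $ column_of j $ k))"
proof -
  have D: "(diag_zero x ** B) $ j $ k = of_real (x $ j) * B $ column_of j $ k" for j
    by (simp add: matrix_matrix_mult_def diag_zero_nth if_distrib[of "\<lambda>a. a * _"] cong: if_cong)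
  have "(A ** diag_zero x ** B) $ i $ k = (\<Sum>j\<in>UNIV. A $ i $ j * (diag_zero x ** B) $ j $ k)"
    unfolding matrix_mul_assoc[symmetric] by (simp add: matrix_matrix_mult_def[of A])
  then show ?thesis by (simp add: D mult_ac)
qed

end

section \<open>Comparing two singular value decompositions\<close>

lemma bounded_bilinear_matrix_mult:
  "bounded_bilinear ((**) :: 'a::real_or_complex^'n^'m \<Rightarrow> 'a^'p^'n \<Rightarrow> 'a^'p^'m)"
  unfolding bilinear_conv_bounded_bilinear[symmetric] bilinear_def
  by (auto intro!: linearI simp: matrix_matrix_mult_def vec_eq_iff sum.distrib distrib_left distrib_right
      scaleR_sum_right)

definition sv_matrix :: "('a::real_or_complex, 'm, 'm) matrix \<Rightarrow> ('a, 'n, 'n) matrix \<Rightarrow>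
    (real, 'm::{finite,linorder}) vec \<Rightarrow> ('a, 'm, 'n::{finite,linorder}) matrix" where
  "sv_matrix U V x = U ** diag_zero x ** adjoint_matrix V"

lemma linear_diag_zero:
  "linear (diag_zero :: _ \<Rightarrow> ('a::real_or_complex, 'm::{finite,linorder}, 'n::{finite,linorder}) matrix)"
  by (rule linearI) (simp_all add: diag_zero_def vec_eq_iff of_real_def scaleR_add_left)

lemma linear_sv_matrix: "linear (sv_matrix U V)"
  unfolding sv_matrix_def linear_conv_bounded_linear
  by (intro bounded_linear_compose[OF bounded_bilinear.bounded_linear_left[OF bounded_bilinear_matrix_mult]]
      bounded_linear_compose[OF bounded_bilinear.bounded_linear_right[OF bounded_bilinear_matrix_mult]]
      linear_diag_zero[unfolded linear_conv_bounded_linear])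

lemma inner_sv_matrix_left:
  "sv_matrix U V x \<bullet> Z = diag_zero x \<bullet> (adjoint_matrix U ** Z ** V)"
  unfolding sv_matrix_def matrix_mul_assoc[symmetric] inner_matrix_mult_left[of U]
    inner_matrix_mult_right[of "diag_zero x"] adjoint_adjoint ..

text \<open>
  With \<open>W = U\<^sup>* U'\<close> and \<open>R = V'\<^sup>* V\<close>, the coefficient of \<open>y\<^sub>i z\<^sub>j\<close> in the inner product is the real part
  of \<open>W\<^sub>i\<^sub>j\<close> times an entry of \<open>R\<close>.  It is at most the mean of their squared absolute values, and the
  rows and columns of unitary matrices have norm 1.
\<close>

lemma exists_substochastic_inner_sv_matrix:
  fixes U U' :: "('a::real_or_complex, 'm::{finite,linorder}, 'm) matrix"
    and V V' :: "('a, 'n::{finite,linorder}, 'n) matrix"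
  assumes dims: "CARD('m) \<le> CARD('n)"
    and unitary: "unitary_matrix U" "unitary_matrix V" "unitary_matrix U'" "unitary_matrix V'"
  shows "\<exists>S. abs_doubly_substochastic S \<and> (\<forall>y z. sv_matrix U V y \<bullet> sv_matrix U' V' z = y \<bullet> (S *v z))"
proof -
  define c where "c = (column_of :: 'm \<Rightarrow> 'n)"
  define W R where "W = adjoint_matrix U ** U'" and "R = adjoint_matrix V' ** V"
  define S :: "(real, 'm, 'm) matrix" where "S = (\<chi> i j. 1 \<bullet> (W $ i $ j * R $ c j $ c i))"
  have W: "unitary_matrix W" and R: "unitary_matrix R"
    unfolding W_def R_def using unitary by (auto intro: unitary_matrix_mult unitary_matrix_adjoint)
  have inj: "inj c" unfolding c_def by (rule inj_column_of[OF dims])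
  have le: "\<bar>S $ i $ j\<bar> \<le> ((norm (W $ i $ j))\<^sup>2 + (norm (R $ c j $ c i))\<^sup>2) / 2" for i j
  proof -
    have "\<bar>S $ i $ j\<bar> \<le> norm (W $ i $ j) * norm (R $ c j $ c i)"
      using Cauchy_Schwarz_ineq2[of "1::'a" "W $ i $ j * R $ c j $ c i"] by (simp add: S_def norm_mult)
    also have "\<dots> \<le> ((norm (W $ i $ j))\<^sup>2 + (norm (R $ c j $ c i))\<^sup>2) / 2"
      using sum_squares_bound[of "norm (W $ i $ j)" "norm (R $ c j $ c i)"] by simp
    finally show ?thesis .
  qed
  have R1: "(\<Sum>j\<in>UNIV. (norm (R $ c j $ c i))\<^sup>2) \<le> 1" for i
  proof -
    have "(\<Sum>j\<in>UNIV. (norm (R $ c j $ c i))\<^sup>2) = (\<Sum>k\<in>range c. (norm (R $ k $ c i))\<^sup>2)"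
      by (simp add: sum.reindex[OF inj])
    also have "\<dots> \<le> (\<Sum>k\<in>UNIV. (norm (R $ k $ c i))\<^sup>2)" by (intro sum_mono2) auto
    finally show ?thesis by (simp add: sum_norm_column_unitary[OF R])
  qed
  have R2: "(\<Sum>i\<in>UNIV. (norm (R $ c j $ c i))\<^sup>2) \<le> 1" for j
  proof -
    have "(\<Sum>i\<in>UNIV. (norm (R $ c j $ c i))\<^sup>2) = (\<Sum>k\<in>range c. (norm (R $ c j $ k))\<^sup>2)"
      by (simp add: sum.reindex[OF inj])
    also have "\<dots> \<le> (\<Sum>k\<in>UNIV. (norm (R $ c j $ k))\<^sup>2)" by (intro sum_mono2) auto
    finally show ?thesis by (simp add: sum_norm_row_unitary[OF R])
  qed
  have S1: "(\<Sum>j\<in>UNIV. \<bar>S $ i $ j\<bar>)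
      \<le> ((\<Sum>j\<in>UNIV. (norm (W $ i $ j))\<^sup>2) + (\<Sum>j\<in>UNIV. (norm (R $ c j $ c i))\<^sup>2)) / 2" for i
    unfolding sum.distrib[symmetric] sum_divide_distrib by (intro sum_mono le)
  have S2: "(\<Sum>i\<in>UNIV. \<bar>S $ i $ j\<bar>)
      \<le> ((\<Sum>i\<in>UNIV. (norm (W $ i $ j))\<^sup>2) + (\<Sum>i\<in>UNIV. (norm (R $ c j $ c i))\<^sup>2)) / 2" for j
    unfolding sum.distrib[symmetric] sum_divide_distrib by (intro sum_mono le)
  have "(\<Sum>j\<in>UNIV. \<bar>S $ i $ j\<bar>) \<le> 1" for i
    using S1[of i] R1[of i] by (simp add: sum_norm_row_unitary[OF W])
  moreover have "(\<Sum>i\<in>UNIV. \<bar>S $ i $ j\<bar>) \<le> 1" for j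
    using S2[of j] R2[of j] by (simp add: sum_norm_column_unitary[OF W])
  ultimately have "abs_doubly_substochastic S"
    by (simp add: abs_doubly_substochastic_def)
  moreover have "sv_matrix U V y \<bullet> sv_matrix U' V' z = y \<bullet> (S *v z)" for y z
  proof -
    have "sv_matrix U V y \<bullet> sv_matrix U' V' z = diag_zero y \<bullet> (W ** diag_zero z ** R)"
      unfolding inner_sv_matrix_left W_def R_def by (simp add: sv_matrix_def matrix_mul_assoc)
    also have "\<dots> = (\<Sum>i\<in>UNIV. y $ i * (\<Sum>j\<in>UNIV. z $ j * S $ i $ j))"
      by (simp add: inner_diag_zero[OF dims] diag_zero_mult_nth[OF dims] inner_sum_right S_def c_def
          flip: scaleR_conv_of_real)
    also have "\<dots> = y \<bullet> (S *v z)"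
      by (simp add: inner_vec_def matrix_vector_mult_def mult.commute)
    finally show ?thesis .
  qed
  ultimately show ?thesis by blast
qed

lemma inner_sv_matrix_same:
  fixes U :: "('a::real_or_complex, 'm::{finite,linorder}, 'm) matrix" and V :: "('a, 'n::{finite,linorder}, 'n) matrix"
  assumes dims: "CARD('m) \<le> CARD('n)" and "unitary_matrix U" "unitary_matrix V"
  shows "sv_matrix U V x \<bullet> sv_matrix U V y = x \<bullet> y"
proof -
  have "adjoint_matrix U ** sv_matrix U V y ** V
      = (adjoint_matrix U ** U) ** diag_zero y ** (adjoint_matrix V ** V)"
    by (simp add: sv_matrix_def matrix_mul_assoc)
  also have "\<dots> = diag_zero y"
    using assms by (simp add: unitary_matrix_def)
  finally have "sv_matrix U V x \<bullet> sv_matrix U V y = (diag_zero x :: ('a, 'm, 'n) matrix) \<bullet> diag_zero y"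
    by (simp add: inner_sv_matrix_left)
  also have "\<dots> = (\<Sum>i\<in>UNIV. x $ i * (1 \<bullet> (of_real (y $ i) * (1::'a))))"
    by (simp add: inner_diag_zero[OF dims] diag_zero_nth[OF dims])
  also have "\<dots> = x \<bullet> y"
  proof -
    have "1 \<bullet> (of_real r * (1::'a)) = r" for r
    proof -
      have "1 \<bullet> (of_real r * (1::'a)) = of_real r \<bullet> (1::'a)"
        unfolding mult_1_right by (rule inner_commute)
      also have "\<dots> = r * (norm (1::'a))\<^sup>2"
        unfolding inner_of_real_mult power2_norm_eq_inner ..
      finally show ?thesis by simp
    qed
    then show ?thesis by (simp only: inner_vec_def inner_real_def)
  qed
  finally show ?thesis .
qed

lemma norm_sv_matrix:
  fixes U :: "('a::real_or_complex, 'm::{finite,linorder}, 'm) matrix" and V :: "('a, 'n::{finite,linorder}, 'n) matrix"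
  assumes "CARD('m) \<le> CARD('n)" "unitary_matrix U" "unitary_matrix V"
  shows "norm (sv_matrix U V x) = norm x"
  using inner_sv_matrix_same[OF assms] by (simp add: norm_eq_sqrt_inner)

lemma inner_mult_vec_eq: "(y :: real^'m) \<bullet> (S *v z) = (\<chi> i j. y $ i * z $ j) \<bullet> S"
  by (simp add: inner_vec_def matrix_vector_mult_def sum_distrib_left mult_ac)

text \<open>
  Signed permutations satisfy the same formula as the mixing matrix \<open>S\<close> of two decompositions, and it
  is affine in the matrix.  This is what allows inequalities to be transferred from signed
  permutations to \<open>S\<close>.
\<close>

lemma norm_diff_signed_permutation:
  assumes "signed_permutation_matrix Q"
  shows "(norm (y - Q *v z))\<^sup>2 = (norm y)\<^sup>2 + (norm z)\<^sup>2 - 2 * ((\<chi> i j. y $ i * z $ j) \<bullet> Q)"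
proof -
  have "(norm (y - Q *v z))\<^sup>2 = (norm y)\<^sup>2 + (norm (Q *v z))\<^sup>2 - 2 * (y \<bullet> (Q *v z))"
    by (simp add: power2_norm_eq_inner inner_diff_left inner_diff_right inner_commute)
  then show ?thesis
    by (simp add: norm_signed_permutation_matrix_mult[OF assms] inner_mult_vec_eq)
qed

context
  fixes U U' :: "('a::real_or_complex, 'm::{finite,linorder}, 'm) matrix"
    and V V' :: "('a, 'n::{finite,linorder}, 'n) matrix"
  assumes dims: "CARD('m) \<le> CARD('n)"
    and unitary: "unitary_matrix U" "unitary_matrix V" "unitary_matrix U'" "unitary_matrix V'"
begin

lemma exists_substochastic_norm_diff_sv_matrix:
  "\<exists>S. abs_doubly_substochastic S \<and> (\<forall>y z. (norm (sv_matrix U V y - sv_matrix U' V' z))\<^sup>2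
      = (norm y)\<^sup>2 + (norm z)\<^sup>2 - 2 * ((\<chi> i j. y $ i * z $ j) \<bullet> S))"
proof -
  obtain S where S: "abs_doubly_substochastic S" "\<forall>y z. sv_matrix U V y \<bullet> sv_matrix U' V' z = y \<bullet> (S *v z)"
    using exists_substochastic_inner_sv_matrix[OF dims unitary] by (elim exE conjE) (rule that)
  have "(norm (sv_matrix U V y - sv_matrix U' V' z))\<^sup>2
      = (norm y)\<^sup>2 + (norm z)\<^sup>2 - 2 * ((\<chi> i j. y $ i * z $ j) \<bullet> S)" for y z
  proof -
    have "(norm (sv_matrix U V y - sv_matrix U' V' z))\<^sup>2
        = (norm (sv_matrix U V y))\<^sup>2 + (norm (sv_matrix U' V' z))\<^sup>2 - 2 * (sv_matrix U V y \<bullet> sv_matrix U' V' z)"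
      by (simp add: power2_norm_eq_inner inner_diff_left inner_diff_right inner_commute)
    then show ?thesis
      by (simp add: norm_sv_matrix dims unitary S(2) inner_mult_vec_eq)
  qed
  with S(1) show ?thesis by blast
qed

text \<open>
  The difference of the squares of the two sides is affine in \<open>S\<close> and nonnegative at all signed
  permutation matrices.
\<close>

lemma norm_diff_sv_matrix_le:
  assumes le: "\<And>Q. signed_permutation_matrix Q \<Longrightarrow> norm (a - Q *v b) \<le> K * norm (y - Q *v z)"
    and "0 \<le> K"
  shows "norm (sv_matrix U V a - sv_matrix U' V' b) \<le> K * norm (sv_matrix U V y - sv_matrix U' V' z)"
proof -
  obtain S where S: "abs_doubly_substochastic S"
    and dist: "\<forall>y z. (norm (sv_matrix U V y - sv_matrix U' V' z))\<^sup>2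
      = (norm y)\<^sup>2 + (norm z)\<^sup>2 - 2 * ((\<chi> i j. y $ i * z $ j) \<bullet> S)"
    using exists_substochastic_norm_diff_sv_matrix by (elim exE conjE) (rule that)
  define M :: "(real, 'm, 'm) matrix" where "M = 2 *\<^sub>R (\<chi> i j. a $ i * b $ j) - (2 * K\<^sup>2) *\<^sub>R (\<chi> i j. y $ i * z $ j)"
  define c where "c = (norm a)\<^sup>2 + (norm b)\<^sup>2 - K\<^sup>2 * ((norm y)\<^sup>2 + (norm z)\<^sup>2)"
  have M: "M \<bullet> Q = 2 * ((\<chi> i j. a $ i * b $ j) \<bullet> Q) - 2 * K\<^sup>2 * ((\<chi> i j. y $ i * z $ j) \<bullet> Q)" for Q
    by (simp add: M_def inner_diff_left)
  have "c \<le> M \<bullet> Q" if "signed_permutation_matrix Q" for Q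
  proof -
    have "(norm (a - Q *v b))\<^sup>2 \<le> K\<^sup>2 * (norm (y - Q *v z))\<^sup>2"
      using le[OF that] by (metis norm_ge_zero power_mono power_mult_distrib)
    then show ?thesis
      unfolding norm_diff_signed_permutation[OF that] M c_def by (simp add: algebra_simps)
  qed
  then have "c \<le> M \<bullet> S"
    by (rule inner_ge_if_signed_permutation_matrix_inner_ge[OF S])
  then have "(norm (sv_matrix U V a - sv_matrix U' V' b))\<^sup>2 \<le> (K * norm (sv_matrix U V y - sv_matrix U' V' z))\<^sup>2"
    unfolding power_mult_distrib dist[rule_format] M c_def by (simp add: algebra_simps)
  then show ?thesis
    by (rule power2_le_imp_le) (simp add: \<open>0 \<le> K\<close>)
qed

text \<open>
  A form of Mirsky's inequality: the squared distance is an affine function of \<open>S\<close> and thus at least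
  its minimum over the signed permutation matrices.
\<close>

lemma exists_signed_permutation_norm_le_norm_diff_sv_matrix:
  "\<exists>Q. signed_permutation_matrix Q \<and> norm (y - Q *v z) \<le> norm (sv_matrix U V y - sv_matrix U' V' z)"
proof -
  obtain S where S: "abs_doubly_substochastic S"
    and dist: "\<forall>y z. (norm (sv_matrix U V y - sv_matrix U' V' z))\<^sup>2
      = (norm y)\<^sup>2 + (norm z)\<^sup>2 - 2 * ((\<chi> i j. y $ i * z $ j) \<bullet> S)"
    using exists_substochastic_norm_diff_sv_matrix by (elim exE conjE) (rule that)
  define M :: "(real, 'm, 'm) matrix" where "M = - (\<chi> i j. y $ i * z $ j)"
  have "{Q :: (real, 'm, 'm) matrix. signed_permutation_matrix Q} \<noteq> {}"
    using signed_permutation_matrix_one by blast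
  then obtain Q0 where Q0: "signed_permutation_matrix Q0"
    "\<And>Q. signed_permutation_matrix Q \<Longrightarrow> M \<bullet> Q0 \<le> M \<bullet> Q"
    using ex_min_if_finite[of "(\<lambda>Q. M \<bullet> Q) ` {Q. signed_permutation_matrix Q}"]
      finite_signed_permutation_matrices[where ?'m='m] by (auto simp: not_less)
  have "M \<bullet> Q0 \<le> M \<bullet> S"
    by (rule inner_ge_if_signed_permutation_matrix_inner_ge[OF S Q0(2)])
  then have "(norm (y - Q0 *v z))\<^sup>2 \<le> (norm (sv_matrix U V y - sv_matrix U' V' z))\<^sup>2"
    unfolding dist[rule_format] norm_diff_signed_permutation[OF Q0(1)] M_def by simp
  then have "norm (y - Q0 *v z) \<le> norm (sv_matrix U V y - sv_matrix U' V' z)"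
    by (rule power2_le_imp_le) simp
  with Q0(1) show ?thesis by blast
qed

text \<open>
  Independence of the decomposition.  There are finitely many signed permutations \<open>Q\<close>, and
  \<open>g y = Q *v g z\<close> whenever \<open>y = Q *v z\<close>; hence some \<open>K\<close> satisfies
  \<open>norm (g y - Q *v g z) \<le> K * norm (y - Q *v z)\<close> for all of them.  Since \<open>norm_diff_sv_matrix_le\<close> then
  applies, equality of the matrices for \<open>y\<close> and \<open>z\<close> forces equality for \<open>g y\<close> and \<open>g z\<close>.
\<close>

lemma sv_matrix_eqI:
  assumes g: "absolutely_symmetric_on D g" and "z \<in> D"
    and eq: "sv_matrix U V y = sv_matrix U' V' z"
  shows "sv_matrix U V (g y) = sv_matrix U' V' (g z)"
proof -
  have "\<forall>Q\<in>{Q. signed_permutation_matrix Q}. \<forall>\<^sub>F K in at_top. norm (g y - Q *v g z) \<le> K * norm (y - Q *v z)"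
  proof
    fix Q :: "(real, 'm, 'm) matrix" assume "Q \<in> {Q. signed_permutation_matrix Q}"
    then have Q: "signed_permutation_matrix Q" by simp
    show "\<forall>\<^sub>F K in at_top. norm (g y - Q *v g z) \<le> K * norm (y - Q *v z)"
    proof (cases "y = Q *v z")
      case True
      then show ?thesis
        using g Q \<open>z \<in> D\<close> by (simp add: absolutely_symmetric_on_def)
    next
      case False
      then have "norm (g y - Q *v g z) \<le> K * norm (y - Q *v z)"
        if "norm (g y - Q *v g z) / norm (y - Q *v z) \<le> K" for K
        using that by (simp add: divide_le_eq)
      then show ?thesis
        by (rule eventually_mono[OF eventually_ge_at_top])
    qed
  qed
  then have "\<forall>\<^sub>F K in at_top. \<forall>Q\<in>{Q. signed_permutation_matrix Q}. norm (g y - Q *v g z) \<le> K * norm (y - Q *v z)"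
    by (rule eventually_ball_finite[OF finite_signed_permutation_matrices])
  from eventually_happens'[OF trivial_limit_at_top_linorder eventually_conj[OF this eventually_ge_at_top[of 0]]]
  obtain K where K: "\<forall>Q\<in>{Q. signed_permutation_matrix Q}. norm (g y - Q *v g z) \<le> K * norm (y - Q *v z)"
    and "0 \<le> K"
    by (elim exE conjE) (rule that)
  have "norm (sv_matrix U V (g y) - sv_matrix U' V' (g z)) \<le> K * norm (sv_matrix U V y - sv_matrix U' V' z)"
    using K \<open>0 \<le> K\<close> by (intro norm_diff_sv_matrix_le) simp_all
  with eq show ?thesis by simp
qed

end

section \<open>Continuous differentiability and polynomial spectral operators\<close>

text \<open>
  On a Euclidean space it suffices that the derivative be continuous in each direction, because
  finitely many directions control the operator norm.  This form makes the closure properties below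
  routine.
\<close>

lemma continuously_differentiable_at_iff:
  fixes f :: "'a::euclidean_space \<Rightarrow> 'b::real_normed_vector"
  shows "continuously_differentiable_at f x \<longleftrightarrow>
    (\<exists>W F. open W \<and> x \<in> W \<and> (\<forall>y\<in>W. (f has_derivative F y) (at y)) \<and> (\<forall>e. isCont (\<lambda>y. F y e) x))"
    (is "?L \<longleftrightarrow> ?R")
proof
  assume ?L
  then obtain W and f' :: "'a \<Rightarrow> 'a \<Rightarrow>\<^sub>L 'b" where *: "open W" "x \<in> W" 
    "\<forall>y\<in>W. (f has_derivative blinfun_apply (f' y)) (at y)" "isCont f' x"
    unfolding continuously_differentiable_at_def by blast
  have "isCont (\<lambda>y. blinfun_apply (f' y) e) x" for e
    by (rule bounded_bilinear.isCont[OF bounded_bilinear_blinfun_apply *(4) continuous_const])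
  with *(1-3) show ?R
    by (intro exI[of _ W] exI[of _ "\<lambda>y. blinfun_apply (f' y)"]) blast
next
  assume ?R
  then obtain W F where *: "open W" "x \<in> W" "\<forall>y\<in>W. (f has_derivative F y) (at y)"
    "\<forall>e. isCont (\<lambda>y. F y e) x" by blast
  have F: "blinfun_apply (Blinfun (F y)) = F y" if "y \<in> W" for y
    using * that by (intro bounded_linear_Blinfun_apply has_derivative_bounded_linear) blast
  have "isCont (\<lambda>y. blinfun_apply (Blinfun (F y)) e) x" for e
  proof -
    have "\<forall>\<^sub>F y in nhds x. y \<in> W" using * by (simp add: eventually_nhds_in_open)
    then have "\<forall>\<^sub>F y in nhds x. blinfun_apply (Blinfun (F y)) e = F y e"
      by eventually_elim (simp add: F)
    then show ?thesis using *(4) isCont_cong by fast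
  qed
  then have "isCont (\<lambda>y. Blinfun (F y)) x" by (intro continuous_blinfun_componentwiseI1) 
  then show ?L
    unfolding continuously_differentiable_at_def using * F
    by (intro exI[of _ W] exI[of _ "\<lambda>y. Blinfun (F y)"]) simp
qed

lemma continuously_differentiable_at_imp_isCont:
  "continuously_differentiable_at f x \<Longrightarrow> isCont f x"
  unfolding continuously_differentiable_at_def by (metis has_derivative_continuous)

lemma continuously_differentiable_at_cong:
  assumes "continuously_differentiable_at f x" "open A" "x \<in> A" "\<And>y. y \<in> A \<Longrightarrow> f y = h y"
  shows "continuously_differentiable_at h x"
proof -
  obtain W f' where *: "open W" "x \<in> W" 
    "\<forall>y\<in>W. (f has_derivative blinfun_apply (f' y)) (at y)" "isCont f' x"
    using assms(1) unfolding continuously_differentiable_at_def by blast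
  have "(h has_derivative blinfun_apply (f' y)) (at y)" if "y \<in> W \<inter> A" for y
  proof (rule has_derivative_transform_within_open[OF _ assms(2)])
    show "(f has_derivative blinfun_apply (f' y)) (at y)" using *(3) that by blast
    show "y \<in> A" using that by blast
  qed (rule assms(4))
  then have "\<forall>y\<in>W \<inter> A. (h has_derivative blinfun_apply (f' y)) (at y)" by blast
  moreover have "open (W \<inter> A)" "x \<in> W \<inter> A" using * assms(2,3) by (simp_all add: open_Int)
  ultimately show ?thesis
    unfolding continuously_differentiable_at_def using *(4)
    by (intro exI[of _ "W \<inter> A"] exI[of _ f'] conjI)
qed

lemma continuously_differentiable_at_bilinear:
  fixes f :: "'a::euclidean_space \<Rightarrow> 'b::real_normed_vector" and g :: "'a \<Rightarrow> 'c::real_normed_vector"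
    and prod :: "'b \<Rightarrow> 'c \<Rightarrow> 'd::real_normed_vector"
  assumes prod: "bounded_bilinear prod"
    and f: "continuously_differentiable_at f x" and g: "continuously_differentiable_at g x"
  shows "continuously_differentiable_at (\<lambda>y. prod (f y) (g y)) x"
proof -
  obtain A F where F: "open A" "x \<in> A" "\<forall>y\<in>A. (f has_derivative F y) (at y)" "\<forall>e. isCont (\<lambda>y. F y e) x"
    using f unfolding continuously_differentiable_at_iff by blast
  obtain B G where G: "open B" "x \<in> B" "\<forall>y\<in>B. (g has_derivative G y) (at y)" "\<forall>e. isCont (\<lambda>y. G y e) x"
    using g unfolding continuously_differentiable_at_iff by blast
  define H where "H y e = prod (f y) (G y e) + prod (F y e) (g y)" for y e
  have "((\<lambda>y. prod (f y) (g y)) has_derivative H y) (at y)" if "y \<in> A \<inter> B" for y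
    unfolding H_def using bounded_bilinear.FDERIV[OF prod] F(3) G(3) that by blast
  moreover have "isCont (\<lambda>y. H y e) x" for e
    unfolding H_def using F(4) G(4) f[THEN continuously_differentiable_at_imp_isCont]
      g[THEN continuously_differentiable_at_imp_isCont]
    by (intro continuous_add bounded_bilinear.isCont[OF prod]) simp_all
  ultimately show ?thesis
    unfolding continuously_differentiable_at_iff using F(1,2) G(1,2)
    by (intro exI[of _ "A \<inter> B"] exI[of _ H]) auto
qed

lemma continuously_differentiable_at_linear:
  fixes f :: "'a::euclidean_space \<Rightarrow> 'b::real_normed_vector"
  assumes L: "bounded_linear L" and f: "continuously_differentiable_at f x"
  shows "continuously_differentiable_at (\<lambda>y. L (f y)) x"
proof -
  obtain A F where F: "open A" "x \<in> A" "\<forall>y\<in>A. (f has_derivative F y) (at y)" "\<forall>e. isCont (\<lambda>y. F y e) x"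
    using f unfolding continuously_differentiable_at_iff by blast
  then show ?thesis
    unfolding continuously_differentiable_at_iff
    by (intro exI[of _ A] exI[of _ "\<lambda>y e. L (F y e)"])
      (auto intro!: bounded_linear.has_derivative[OF L] bounded_linear.isCont[OF L])
qed

lemma continuously_differentiable_at_linear_arg:
  fixes f :: "'b::euclidean_space \<Rightarrow> 'c::real_normed_vector" and L :: "'a::euclidean_space \<Rightarrow> 'b"
  assumes L: "bounded_linear L" and f: "continuously_differentiable_at f (L x)"
  shows "continuously_differentiable_at (\<lambda>y. f (L y)) x"
proof -
  obtain A F where F: "open A" "L x \<in> A" "\<forall>y\<in>A. (f has_derivative F y) (at y)" "\<forall>e. isCont (\<lambda>y. F y e) (L x)"
    using f unfolding continuously_differentiable_at_iff by blast
  have cont: "isCont L x" for x using L by (rule linear_continuous_at)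
  have "open (L -` A)" using F(1) cont by (simp add: continuous_open_vimage)
  moreover have "((\<lambda>y. f (L y)) has_derivative (\<lambda>e. F (L y) (L e))) (at y)" if "y \<in> L -` A" for y
    using has_derivative_compose[OF bounded_linear_imp_has_derivative[OF L], of f "F (L y)" y UNIV] F(3) that
    by simp
  moreover have "isCont (\<lambda>y. F (L y) (L e)) x" for e
    using isCont_o2[OF cont, of x "\<lambda>z. F z (L e)"] F(4) by simp
  ultimately show ?thesis
    unfolding continuously_differentiable_at_iff using F(2)
    by (intro exI[of _ "L -` A"] exI[of _ "\<lambda>y e. F (L y) (L e)"]) auto
qed

lemma continuously_differentiable_at_const: "continuously_differentiable_at (\<lambda>_. c) x"
  for x :: "'a::euclidean_space"
  unfolding continuously_differentiable_at_iff
  by (intro exI[of _ UNIV] exI[of _ "\<lambda>_ _. 0"]) auto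

lemma continuously_differentiable_at_ident: "continuously_differentiable_at (\<lambda>y. y) x"
  for x :: "'a::euclidean_space"
  unfolding continuously_differentiable_at_iff
  by (intro exI[of _ UNIV] exI[of _ "\<lambda>_ e. e"]) auto

lemma continuously_differentiable_at_add:
  fixes f :: "'a::euclidean_space \<Rightarrow> 'b::real_normed_vector"
  assumes "continuously_differentiable_at f x" "continuously_differentiable_at g x"
  shows "continuously_differentiable_at (\<lambda>y. f y + g y) x"
proof -
  obtain A F where F: "open A" "x \<in> A" "\<forall>y\<in>A. (f has_derivative F y) (at y)" "\<forall>e. isCont (\<lambda>y. F y e) x"
    using assms(1) unfolding continuously_differentiable_at_iff by blast
  obtain B G where G: "open B" "x \<in> B" "\<forall>y\<in>B. (g has_derivative G y) (at y)" "\<forall>e. isCont (\<lambda>y. G y e) x"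
    using assms(2) unfolding continuously_differentiable_at_iff by blast
  show ?thesis
    unfolding continuously_differentiable_at_iff using F G
    by (intro exI[of _ "A \<inter> B"] exI[of _ "\<lambda>y e. F y e + G y e"])
      (auto intro!: has_derivative_add continuous_add)
qed

lemma conjugate_of_real [simp]: "conjugate (of_real r :: 'a::real_or_complex) = of_real r"
proof -
  have "\<forall>y. y \<bullet> conjugate (of_real r :: 'a) = y \<bullet> of_real r"
  proof
    fix y :: 'a
    have "y \<bullet> conjugate (of_real r) = (of_real r * y) \<bullet> 1" by (simp add: inner_mult_left)
    also have "\<dots> = y \<bullet> of_real r" by (simp add: of_real_def)
    finally show "y \<bullet> conjugate (of_real r :: 'a) = y \<bullet> of_real r" .
  qed
  then show ?thesis by (rule vector_eq_ldot[THEN iffD1])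
qed

lemma bounded_linear_adjoint_matrix: 
  "bounded_linear (adjoint_matrix :: 'a::real_or_complex^'n^'m \<Rightarrow> 'a^'m^'n)"
proof -
  have "conjugate (r *\<^sub>R x) = r *\<^sub>R conjugate x" for r and x :: 'a
    unfolding scaleR_conv_of_real conjugate_dist_mul conjugate_of_real ..
  then show ?thesis
    unfolding linear_conv_bounded_linear[symmetric]
    by (intro linearI) (simp_all add: adjoint_matrix_def vec_eq_iff conjugate_dist_add)
qed

text \<open>
  \<open>P\<close> is the spectral operator of \<open>p\<close>, defined on all matrices and everywhere continuously
  differentiable.
\<close>

definition smooth_lift ::
  "((real, 'm) vec \<Rightarrow> (real, 'm) vec) \<Rightarrow>
   (('a::real_or_complex, 'm::{finite,linorder}, 'n::{finite,linorder}) matrix \<Rightarrow> ('a, 'm, 'n) matrix) \<Rightarrow> bool" where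
  "smooth_lift p P \<longleftrightarrow> (\<forall>X. continuously_differentiable_at P X) \<and>
     (\<forall>U V x. unitary_matrix U \<longrightarrow> unitary_matrix V \<longrightarrow> P (sv_matrix U V x) = sv_matrix U V (p x))"

lemma smooth_liftI:
  assumes "\<And>X. continuously_differentiable_at P X"
    and "\<And>U V x. unitary_matrix U \<Longrightarrow> unitary_matrix V \<Longrightarrow> P (sv_matrix U V x) = sv_matrix U V (p x)"
  shows "smooth_lift p P"
  using assms by (simp add: smooth_lift_def)

lemma smooth_liftD:
  assumes "smooth_lift p P"
  shows "continuously_differentiable_at P X"
    and "unitary_matrix U \<Longrightarrow> unitary_matrix V \<Longrightarrow> P (sv_matrix U V x) = sv_matrix U V (p x)"
  using assms by (simp_all add: smooth_lift_def)

lemma smooth_lift_ident: "smooth_lift (\<lambda>x. x) (\<lambda>X. X)"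
  by (rule smooth_liftI) (rule continuously_differentiable_at_ident, rule refl)

lemma smooth_lift_zero: "smooth_lift (\<lambda>x. 0) (\<lambda>X. 0)"
  by (rule smooth_liftI)
    (rule continuously_differentiable_at_const, rule linear_0[OF linear_sv_matrix, symmetric])

lemma smooth_lift_add:
  assumes "smooth_lift p P" "smooth_lift q Q"
  shows "smooth_lift (\<lambda>x. p x + q x) (\<lambda>X. P X + Q X)"
  using assms
  by (intro smooth_liftI continuously_differentiable_at_add)
    (simp_all add: smooth_liftD linear_add[OF linear_sv_matrix])

lemma smooth_lift_scaleR:
  assumes "smooth_lift p P"
  shows "smooth_lift (\<lambda>x. c *\<^sub>R p x) (\<lambda>X. c *\<^sub>R P X)"
  using assms
  by (intro smooth_liftI continuously_differentiable_at_linear[OF bounded_linear_scaleR_right])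
    (simp_all add: smooth_liftD linear_cmul[OF linear_sv_matrix])

lemma smooth_lift_sum:
  assumes "finite A" "\<And>a. a \<in> A \<Longrightarrow> smooth_lift (p a) (P a)"
  shows "smooth_lift (\<lambda>x. \<Sum>a\<in>A. p a x) (\<lambda>X. \<Sum>a\<in>A. P a X)"
  using assms
proof (induction rule: finite_induct)
  case empty
  show ?case unfolding sum.empty by (rule smooth_lift_zero)
next
  case (insert a A)
  then have "smooth_lift (\<lambda>x. p a x + (\<Sum>a\<in>A. p a x)) (\<lambda>X. P a X + (\<Sum>a\<in>A. P a X))"
    by (intro smooth_lift_add) simp_all
  with insert show ?case by simp
qed

text \<open>
  Coefficients that depend symmetrically on all singular values, such as sums of even polynomials of
  them, arise as inner products of two lifted maps.
\<close>

lemma smooth_lift_inner_scaleR: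
  fixes P Q R :: "('a::real_or_complex, 'm::{finite,linorder}, 'n::{finite,linorder}) matrix \<Rightarrow> ('a, 'm, 'n) matrix"
  assumes "CARD('m) \<le> CARD('n)" "smooth_lift p P" "smooth_lift q Q" "smooth_lift r R"
  shows "smooth_lift (\<lambda>x. (p x \<bullet> q x) *\<^sub>R r x) (\<lambda>X. (P X \<bullet> Q X) *\<^sub>R R X)"
  using assms
  by (intro smooth_liftI continuously_differentiable_at_bilinear[OF bounded_bilinear_scaleR]
      continuously_differentiable_at_bilinear[OF bounded_bilinear_inner])
    (simp_all add: smooth_liftD inner_sv_matrix_same linear_cmul[OF linear_sv_matrix])

lemma diag_zero_mult_adjoint:
  assumes dims: "CARD('m::{finite,linorder}) \<le> CARD('n::{finite,linorder})"
  shows "(diag_zero x :: ('a::real_or_complex, 'm, 'n) matrix) ** adjoint_matrix (diag_zero x) ** diag_zero y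
    = (diag_zero (\<chi> i. (x $ i)\<^sup>2 * y $ i) :: ('a, 'm, 'n) matrix)"
proof -
  let ?D = "diag_zero x :: ('a, 'm, 'n) matrix"
  have "(?D ** adjoint_matrix ?D) $ i $ j = (if i = j then of_real ((x $ i)\<^sup>2) else 0)" for i j
  proof -
    have "(?D ** adjoint_matrix ?D) $ i $ j
        = (\<Sum>k\<in>UNIV. if k = column_of i then of_real (x $ i) * conjugate (?D $ j $ k) else 0)"
      by (simp add: matrix_matrix_mult_def adjoint_matrix_def diag_zero_nth[OF dims]
          if_distrib[of "\<lambda>a. a * _"] cong: if_cong)
    also have "\<dots> = of_real (x $ i) * conjugate (?D $ j $ column_of i)" by simp
    also have "\<dots> = (if i = j then of_real ((x $ i)\<^sup>2) else 0)"
      by (auto simp: diag_zero_nth[OF dims] power2_eq_square dest: injD[OF inj_column_of[OF dims]])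
    finally show ?thesis .
  qed
  then show ?thesis
    by (simp add: vec_eq_iff matrix_matrix_mult_def[of "?D ** adjoint_matrix ?D"] diag_zero_nth[OF dims]
        if_distrib[of "\<lambda>a. a * _"] cong: if_cong)
qed

text \<open>
  Multiplying each coordinate by \<open>x\<^sub>i\<^sup>2\<close> corresponds to multiplying the matrix by \<open>X X\<^sup>*\<close>.  Starting from
  the identity, this gives all odd polynomials applied coordinatewise.
\<close>

lemma smooth_lift_square:
  fixes P :: "('a::real_or_complex, 'm::{finite,linorder}, 'n::{finite,linorder}) matrix \<Rightarrow> ('a, 'm, 'n) matrix"
  assumes dims: "CARD('m) \<le> CARD('n)" and P: "smooth_lift p P"
  shows "smooth_lift (\<lambda>x. \<chi> i. (x $ i)\<^sup>2 * p x $ i) (\<lambda>X. X ** adjoint_matrix X ** P X)"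
proof -
  have "sv_matrix U V x ** adjoint_matrix (sv_matrix U V x) ** sv_matrix U V y
      = sv_matrix U V (\<chi> i. (x $ i)\<^sup>2 * y $ i)"
    if "unitary_matrix U" "unitary_matrix V" for U :: "('a, 'm, 'm) matrix" and V :: "('a, 'n, 'n) matrix" and x y
  proof -
    have "sv_matrix U V x ** adjoint_matrix (sv_matrix U V x) ** sv_matrix U V y
        = U ** (diag_zero x ** (adjoint_matrix V ** V) ** adjoint_matrix (diag_zero x) **
            (adjoint_matrix U ** U) ** diag_zero y) ** adjoint_matrix V"
      by (simp add: sv_matrix_def adjoint_matrix_mult matrix_mul_assoc)
    then show ?thesis
      using that by (simp add: unitary_matrix_def diag_zero_mult_adjoint[OF dims] sv_matrix_def)
  qed
  then show ?thesis
    using P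
    by (intro smooth_liftI continuously_differentiable_at_bilinear[OF bounded_bilinear_matrix_mult]
        continuously_differentiable_at_ident continuously_differentiable_at_linear[OF bounded_linear_adjoint_matrix])
      (simp_all add: smooth_liftD)
qed

definition odd_poly :: "real poly \<Rightarrow> (real, 'm) vec \<Rightarrow> (real, 'm::finite) vec" where
  "odd_poly f x = (\<chi> i. x $ i * poly f ((x $ i)\<^sup>2))"

lemma exists_smooth_lift_odd_poly:
  assumes dims: "CARD('m::{finite,linorder}) \<le> CARD('n::{finite,linorder})"
  shows "\<exists>P :: ('a::real_or_complex, 'm, 'n) matrix \<Rightarrow> ('a, 'm, 'n) matrix. smooth_lift (odd_poly f) P"
proof (induction f)
  case 0
  have "odd_poly 0 = (\<lambda>x :: (real, 'm) vec. 0)"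
    by (simp add: odd_poly_def fun_eq_iff vec_eq_iff)
  then show ?case by (simp only:) (intro exI, rule smooth_lift_zero)
next
  case (pCons c f)
  then obtain P where P: "smooth_lift (odd_poly f) (P :: ('a, 'm, 'n) matrix \<Rightarrow> ('a, 'm, 'n) matrix)"
    by blast
  have *: "odd_poly (pCons c f) = (\<lambda>x :: (real, 'm) vec. c *\<^sub>R x + (\<chi> i. (x $ i)\<^sup>2 * odd_poly f x $ i))"
    by (simp add: odd_poly_def fun_eq_iff vec_eq_iff algebra_simps)
  have "smooth_lift (\<lambda>x. c *\<^sub>R x + (\<chi> i. (x $ i)\<^sup>2 * odd_poly f x $ i)) (\<lambda>X. c *\<^sub>R X + X ** adjoint_matrix X ** P X)"
    by (rule smooth_lift_add[OF smooth_lift_scaleR[OF smooth_lift_ident] smooth_lift_square[OF dims P]])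
  then show ?case
    unfolding * by (intro exI)
qed

section \<open>Prescribing the first-order behaviour of an equivariant map\<close>

text \<open>
  A new node \<open>b\<close> is added by a multiple of the squared product of all \<open>x - a\<close>, which changes neither
  values nor derivatives at the old nodes.
\<close>

lemma exists_hermite_interpolation:
  fixes v d :: "real \<Rightarrow> real"
  assumes "finite A"
  shows "\<exists>f. \<forall>a\<in>A. poly f a = v a \<and> poly (pderiv f) a = d a"
  using assms
proof (induction rule: finite_induct)
  case (insert b A)
  then obtain f where f: "\<forall>a\<in>A. poly f a = v a \<and> poly (pderiv f) a = d a" by blast
  define u where "u = (\<Prod>a\<in>A. [:- a, 1:])"
  have u: "poly u x = 0 \<longleftrightarrow> x \<in> A" for x
    using insert.hyps(1) by (simp add: u_def poly_prod)
  define w where "w = u * u"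
  have w: "poly w a = 0" "poly (pderiv w) a = 0" if "a \<in> A" for a
    using u that by (simp_all add: w_def pderiv_mult)
  have wb: "poly w b \<noteq> 0" using u insert.hyps(2) by (simp add: w_def)
  define p where "p = (v b - poly f b) / poly w b"
  define q where "q = (d b - poly (pderiv f) b - poly (pderiv w) b * p) / poly w b"
  define r where "r = [:p - q * b, q:]"
  have r: "poly r b = p" "poly (pderiv r) b = q"
    by (simp_all add: r_def pderiv_pCons)
  define h where "h = f + w * r"
  have "poly h a = v a \<and> poly (pderiv h) a = d a" if "a \<in> A" for a
    using f w that by (simp add: h_def pderiv_add pderiv_mult)
  moreover have "poly h b = v b"
    using wb r by (simp add: h_def p_def)
  moreover have "poly (pderiv h) b = d b"
  proof -
    have "poly (pderiv h) b = poly (pderiv f) b + poly w b * q + poly (pderiv w) b * p"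
      by (simp add: h_def pderiv_add pderiv_mult r)
    also have "poly w b * q = d b - poly (pderiv f) b - poly (pderiv w) b * p"
      using wb by (simp add: q_def)
    finally show ?thesis by simp
  qed
  ultimately show ?case by (intro exI[of _ h]) simp
qed simp

lemma has_derivative_odd_poly:
  "(odd_poly f has_derivative
     (\<lambda>e. \<chi> i. (poly f ((y $ i)\<^sup>2) + 2 * (y $ i)\<^sup>2 * poly (pderiv f) ((y $ i)\<^sup>2)) * e $ i)) (at y)"
proof -
  have D: "((\<lambda>t. t * poly f (t\<^sup>2)) has_real_derivative poly f (t\<^sup>2) + 2 * t\<^sup>2 * poly (pderiv f) (t\<^sup>2)) (at t)" for t
    by (rule derivative_eq_intros poly_DERIV DERIV_chain2[where f="poly f"] refl)+
      (simp add: power2_eq_square)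
  have "((\<lambda>x. x $ i * poly f ((x $ i)\<^sup>2)) has_derivative
      (\<lambda>e. (poly f ((y $ i)\<^sup>2) + 2 * (y $ i)\<^sup>2 * poly (pderiv f) ((y $ i)\<^sup>2)) * e $ i)) (at y)" for i
    using has_derivative_compose[OF bounded_linear_imp_has_derivative[OF bounded_linear_vec_nth]
        D[of "y $ i", unfolded has_field_derivative_def]] .
  then show ?thesis
    unfolding has_derivative_componentwise_within[of "odd_poly f"]
    by (auto simp: Basis_vec_def inner_axis odd_poly_def)
qed

lemma odd_poly_signed_permutation:
  assumes "signed_permutation_matrix Q"
  shows "odd_poly f (Q *v x) = Q *v odd_poly f x"
proof -
  obtain \<pi> s where Q: "bij \<pi>" "\<forall>i. s i = 1 \<or> s i = -1" "Q = signed_perm \<pi> s"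
    using assms by (rule signed_permutation_matrixE)
  have "(s i * a)\<^sup>2 = a\<^sup>2" for i a
    using Q(2)[rule_format, of i] by (auto simp: power2_eq_square)
  then show ?thesis by (simp add: vec_eq_iff odd_poly_def Q(3))
qed

lemma inner_signed_permutation:
  assumes "signed_permutation_matrix Q"
  shows "(Q *v x) \<bullet> (Q *v y) = x \<bullet> y"
  unfolding dot_norm matrix_vector_right_distrib[symmetric] norm_signed_permutation_matrix_mult[OF assms] ..

text \<open>
  Differentiating \<open>g (Q *v x) = Q *v g x\<close> at a fixed point of \<open>Q\<close>.
\<close>

lemma derivative_commutes_with_stabilizer:
  assumes g: "absolutely_symmetric_on D g" and D: "open D" "y \<in> D"
    and M: "(g has_derivative M) (at y)" and Q: "signed_permutation_matrix Q" "Q *v y = y"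
  shows "M (Q *v e) = Q *v M e"
proof -
  have L: "((*v) Q has_derivative (*v) Q) (at y)"
    by (rule bounded_linear_imp_has_derivative[OF matrix_vector_mul_bounded_linear])
  have M': "(g has_derivative M) (at (Q *v y))"
    unfolding Q(2) by (rule M)
  have "((\<lambda>x. g (Q *v x)) has_derivative (\<lambda>e. M (Q *v e))) (at y)"
    by (rule has_derivative_compose[OF L M'])
  moreover have "((\<lambda>x. g (Q *v x)) has_derivative (\<lambda>e. Q *v M e)) (at y)"
  proof (rule has_derivative_transform_within_open[OF _ D])
    show "((\<lambda>x. Q *v g x) has_derivative (\<lambda>e. Q *v M e)) (at y)"
      by (rule bounded_linear.has_derivative[OF matrix_vector_mul_bounded_linear M])
    show "Q *v g x = g (Q *v x)" if "x \<in> D" for x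
      using g that Q(1) unfolding absolutely_symmetric_on_def by simp
  qed
  ultimately have "(\<lambda>e. M (Q *v e)) = (\<lambda>e. Q *v M e)"
    by (rule has_derivative_unique)
  then show ?thesis by (rule fun_cong)
qed

lemma jet_entries_stabilizer:
  assumes g: "absolutely_symmetric_on D g" and D: "open D" "y \<in> D"
    and M: "(g has_derivative M) (at y)"
    and \<pi>: "bij \<pi>" and s: "\<And>i. s i = 1 \<or> s i = -1" and y: "\<And>i. s i * y $ \<pi> i = y $ i"
  shows "g y $ i = s i * g y $ \<pi> i"
    and "matrix M $ i $ j = s i * s j * matrix M $ \<pi> i $ \<pi> j"
proof -
  let ?Q = "signed_perm \<pi> s"
  have Q: "signed_permutation_matrix ?Q" using \<pi> s by (rule signed_permutation_matrix_signed_perm)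
  have fix_y: "?Q *v y = y" by (simp add: vec_eq_iff y)
  have "g y = ?Q *v g y"
    using g D(2) Q fix_y unfolding absolutely_symmetric_on_def by metis
  from arg_cong[OF this, of "\<lambda>x. x $ i"] show "g y $ i = s i * g y $ \<pi> i" by simp
  have lin: "linear M" using M by (rule has_derivative_linear)
  have "?Q *v axis (\<pi> j) 1 = s j *\<^sub>R axis j 1"
    using \<pi> by (auto simp: vec_eq_iff axis_def dest: bij_is_inj injD)
  then have "s j *\<^sub>R M (axis j 1) = ?Q *v M (axis (\<pi> j) 1)"
    using derivative_commutes_with_stabilizer[OF g D M Q fix_y, of "axis (\<pi> j) 1"]
    by (simp add: linear_cmul[OF lin])
  from arg_cong[OF this, of "\<lambda>x. x $ i"]
  have "s j * matrix M $ i $ j = s i * matrix M $ \<pi> i $ \<pi> j" by (simp add: matrix_def)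
  then show "matrix M $ i $ j = s i * s j * matrix M $ \<pi> i $ \<pi> j"
    using s[of j] by auto
qed

text \<open>
  Write \<open>t i = (y $ i)\<^sup>2\<close>.  Since the derivative commutes with all signed permutations that fix \<open>y\<close>, its
  entry \<open>m i j\<close> with \<open>i \<noteq> j\<close> is \<open>y $ i * y $ j\<close> times a function \<open>\<alpha>\<close> of \<open>(t i, t j)\<close>, and its diagonal
  entries as well as the quotients \<open>g y $ i / y $ i\<close> are functions of \<open>t i\<close>.  The map
  \<open>p x = odd_poly \<phi> x + (\<Sum>a b. \<alpha> (a, b) *\<^sub>R (odd_poly (r b) x \<bullet> x) *\<^sub>R odd_poly (q a) x)\<close>
  realizes such data: \<open>q a\<close> selects the coordinates with \<open>t i = a\<close>, the polynomial \<open>r b\<close> vanishes at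
  all nodes and has a derivative selecting \<open>t j = b\<close>, so that the double sum contributes nothing to
  the value at \<open>y\<close> and exactly the terms \<open>\<alpha> (t i, t j) * y $ i * y $ j\<close> to the derivative; \<open>\<phi>\<close> supplies
  the value and the remaining diagonal part.
\<close>

lemma exists_smooth_lift_jet:
  fixes g :: "(real, 'm::{finite,linorder}) vec \<Rightarrow> (real, 'm) vec"
  assumes dims: "CARD('m) \<le> CARD('n::{finite,linorder})"
    and g: "absolutely_symmetric_on D g" and D: "open D" "y \<in> D"
    and M: "(g has_derivative M) (at y)"
  shows "\<exists>p (P :: ('a::real_or_complex, 'm, 'n) matrix \<Rightarrow> ('a, 'm, 'n) matrix). smooth_lift p P \<and>
     absolutely_symmetric_on UNIV p \<and> p y = g y \<and> (p has_derivative M) (at y)"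
proof -
  define m where "m i j = matrix M $ i $ j" for i j
  define t where "t i = (y $ i)\<^sup>2" for i
  note stab = jet_entries_stabilizer[OF g D M, folded m_def]
  \<comment> \<open>Flipping the sign of coordinate \<open>k\<close> fixes \<open>y\<close> when that coordinate is zero.\<close>
  have zero: "g y $ k = 0" "j \<noteq> k \<Longrightarrow> m k j = 0" "j \<noteq> k \<Longrightarrow> m j k = 0" if "y $ k = 0" for j k
  proof -
    have s: "(if i = k then - 1 else 1) = (1::real) \<or> (if i = k then - 1 else 1) = (- 1 :: real)"
      "(if i = k then - 1 else 1) * y $ id i = y $ i" for i
      using that by auto
    note * = stab[of id "\<lambda>i. if i = k then - 1 else 1", OF bij_id s]
    show "g y $ k = 0" using *(1)[of k] by simp
    show "m k j = 0" "m j k = 0" if "j \<noteq> k"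
      using *(2)[of k j] *(2)[of j k] that by simp_all
  qed
  \<comment> \<open>Exchanging coordinates \<open>i\<close> and \<open>j\<close>, with the sign \<open>c\<close> when they differ by it, fixes \<open>y\<close>.\<close>
  have swap: "\<exists>c. (c = 1 \<or> c = - 1) \<and> y $ i = c * y $ j \<and> g y $ i = c * g y $ j \<and> m i i = m j j \<and>
      (\<forall>k l. m k l / (y $ k * y $ l) =
        m (Transposition.transpose i j k) (Transposition.transpose i j l) / (y $ Transposition.transpose i j k * y $ Transposition.transpose i j l))"
    if ne: "i \<noteq> j" and eq: "t i = t j" for i j
  proof -
    have "y $ i = y $ j \<or> y $ i = - (y $ j)"
      using eq unfolding t_def power2_eq_iff .
    then obtain c where c: "c = 1 \<or> c = (- 1 :: real)" "y $ i = c * y $ j"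
      by (metis mult_1 mult_minus1)
    have cc: "c * c = 1" "c * (c * x) = x" for x using c(1) by auto
    define s where "s k = (if k = i \<or> k = j then c else 1)" for k
    have s1: "s k = 1 \<or> s k = - 1" for k
      using c(1) by (simp add: s_def)
    have s2: "s k * y $ Transposition.transpose i j k = y $ k" for k
    proof -
      consider "k = i" | "k = j" | "k \<noteq> i" "k \<noteq> j" by metis
      then show ?thesis
      proof cases
        case 1
        then show ?thesis using c(2) by (simp add: s_def)
      next
        case 2
        then show ?thesis by (simp add: s_def c(2) cc(2))
      qed (simp add: s_def)
    qed
    note s = s1 s2
    have ss: "s k * s k = 1" for k using s(1)[of k] by auto
    note * = stab[OF bij_transpose s]
    have "m k l / (y $ k * y $ l) =
        m (Transposition.transpose i j k) (Transposition.transpose i j l) / (y $ Transposition.transpose i j k * y $ Transposition.transpose i j l)" for k l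
    proof -
      have "m k l / (y $ k * y $ l) = ((s k * s l) * m (Transposition.transpose i j k) (Transposition.transpose i j l)) /
          ((s k * s l) * (y $ Transposition.transpose i j k * y $ Transposition.transpose i j l))"
        unfolding *(2)[of k l] s2[of k, symmetric] s2[of l, symmetric] by (simp only: mult_ac)
      moreover have "s k * s l \<noteq> 0" using s(1)[of k] s(1)[of l] by auto
      ultimately show ?thesis by simp
    qed
    moreover have "g y $ i = c * g y $ j" using *(1)[of i] by (simp add: s_def)
    moreover have "m i i = m j j" using *(2)[of i i] cc by (simp add: s_def)
    ultimately show ?thesis using c by (intro exI[of _ c] conjI allI)
  qed
  have "\<forall>i j. t i = t j \<longrightarrow> m i i = m j j"
    using swap by metis
  then obtain \<mu> where \<mu>: "\<And>i. \<mu> (t i) = m i i"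
    unfolding function_factors_left[of t "\<lambda>i. m i i"] by (auto simp: fun_eq_iff)
  \<comment> \<open>At a zero coordinate the quotient is replaced by the diagonal entry of the derivative,
    which is the slope that \<open>\<phi>\<close> has to produce there.\<close>
  define V where "V i = (if y $ i = 0 then m i i else g y $ i / y $ i)" for i
  have "\<forall>i j. t i = t j \<longrightarrow> V i = V j"
  proof (intro allI impI)
    fix i j assume "t i = t j"
    then show "V i = V j"
    proof (cases "i = j")
      case False
      from swap[OF this \<open>t i = t j\<close>] obtain c where
        "c = 1 \<or> c = (- 1 :: real)" "y $ i = c * y $ j" "g y $ i = c * g y $ j" "m i i = m j j" by blast
      then show ?thesis by (auto simp: V_def)
    qed simp
  qed
  then obtain v where v: "\<And>i. v (t i) = V i"
    unfolding function_factors_left[of t V] by (auto simp: fun_eq_iff)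
  define N where "N = (\<lambda>(i, j). m i j / (y $ i * y $ j))"
  have N: "N (k, l) = N (Transposition.transpose i j k, Transposition.transpose i j l)" if "t i = t j" for i j k l
    using swap[of i j] that by (cases "i = j") (auto simp: N_def)
  have t_transpose: "t (Transposition.transpose i j k) = t k" if "t i = t j" for i j k
    using that by (simp add: Transposition.transpose_def)
  have "\<forall>p q. fst p \<noteq> snd p \<and> fst q \<noteq> snd q \<and> (t (fst p), t (snd p)) = (t (fst q), t (snd q)) \<longrightarrow> N p = N q"
  proof (intro allI impI, clarify)
    fix i j i' j' assume ne: "fst (i, j) \<noteq> snd (i, j)" "fst (i', j') \<noteq> snd (i', j')"
      and t: "t (fst (i, j)) = t (fst (i', j'))" "t (snd (i, j)) = t (snd (i', j'))"
    \<comment> \<open>Two exchanges carry \<open>(i, j)\<close> to \<open>(i', j')\<close>; the first may displace \<open>j\<close>, namely to \<open>j1\<close>.\<close>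
    define j1 where "j1 = Transposition.transpose i i' j"
    have "t j1 = t j'" using t t_transpose[of i i'] by (simp add: j1_def)
    moreover have "i' \<noteq> j1" using ne(1) by (auto simp: j1_def Transposition.transpose_def split: if_splits)
    ultimately have "N (i', j1) = N (i', j')"
      using N[of j1 j' i' j1] ne(2) by simp
    moreover have "N (i, j) = N (i', j1)"
      using N[of i i' i j] t(1) by (simp add: j1_def)
    ultimately show "N (i, j) = N (i', j')" by simp
  qed
  then obtain \<alpha> where \<alpha>: "\<And>i j. i \<noteq> j \<Longrightarrow> N (i, j) = \<alpha> (t i, t j)"
    unfolding function_factors_left_gen[of "\<lambda>p. fst p \<noteq> snd p" "\<lambda>p. (t (fst p), t (snd p))" N] by auto
  have off_diagonal: "m i j = \<alpha> (t i, t j) * (y $ i * y $ j)" if "i \<noteq> j" for i j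
  proof (cases "y $ i = 0 \<or> y $ j = 0")
    case True
    then show ?thesis using zero(2)[of i j] zero(3)[of j i] that by auto
  next
    case False
    then show ?thesis using \<alpha>[OF that] by (simp add: N_def divide_eq_eq)
  qed
  \<comment> \<open>At \<open>a = 0\<close> the quotient is 0 by convention; at a zero coordinate the slope of
    \<open>odd_poly \<phi>\<close> is \<open>v 0\<close> alone.\<close>
  define d where "d a = (\<mu> a - v a - \<alpha> (a, a) * a) / (2 * a)" for a
  have diagonal: "m i i = v (t i) + 2 * t i * d (t i) + \<alpha> (t i, t i) * (y $ i * y $ i)" for i
    using \<mu>[of i] v[of i] by (auto simp: d_def V_def t_def power2_eq_square)
  have fin: "finite (range t)" by simp
  have H: "\<exists>f. \<forall>i. poly f (t i) = v (t i) \<and> poly (pderiv f) (t i) = d (t i)" for v d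
    using exists_hermite_interpolation[OF fin, of v d] by simp
  obtain \<phi> where \<phi>: "\<And>i. poly \<phi> (t i) = v (t i)" "\<And>i. poly (pderiv \<phi>) (t i) = d (t i)"
    using H[of v d] by metis
  have "\<exists>q. \<forall>i. poly q (t i) = (if t i = a then 1 else 0) \<and> poly (pderiv q) (t i) = 0" for a
    by (rule H)
  then obtain q where q: "\<And>a i. poly (q a) (t i) = (if t i = a then 1 else 0)" by metis
  have "\<exists>r. \<forall>i. poly r (t i) = 0 \<and> poly (pderiv r) (t i) = (if t i = b then 1 / (2 * b) else 0)" for b
    by (rule H)
  then obtain r where r: "\<And>b i. poly (r b) (t i) = 0"
    "\<And>b i. poly (pderiv (r b)) (t i) = (if t i = b then 1 / (2 * b) else 0)" by metis
  define T where "T a b x = (odd_poly (r b) x \<bullet> x) *\<^sub>R odd_poly (q a) x" for a b and x :: "(real, 'm) vec"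
  define p where "p x = odd_poly \<phi> x + (\<Sum>a\<in>range t. \<Sum>b\<in>range t. \<alpha> (a, b) *\<^sub>R T a b x)" for x
  have "\<exists>L. \<forall>f. smooth_lift (odd_poly f) (L f :: ('a, 'm, 'n) matrix \<Rightarrow> ('a, 'm, 'n) matrix)"
    using exists_smooth_lift_odd_poly[OF dims] by (rule choice[OF allI])
  then obtain L where L: "\<forall>f. smooth_lift (odd_poly f) (L f :: ('a, 'm, 'n) matrix \<Rightarrow> ('a, 'm, 'n) matrix)" ..
  define P where "P X = L \<phi> X + (\<Sum>a\<in>range t. \<Sum>b\<in>range t. \<alpha> (a, b) *\<^sub>R ((L (r b) X \<bullet> X) *\<^sub>R L (q a) X))" for X
  have r0: "odd_poly (r b) y = 0" for b
    using r(1) by (simp add: odd_poly_def vec_eq_iff flip: t_def)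
  have "p y = odd_poly \<phi> y"
    by (simp add: p_def T_def r0)
  also have "\<dots> = g y"
    using \<phi>(1) v zero(1) by (auto simp: odd_poly_def vec_eq_iff V_def simp flip: t_def)
  finally have py: "p y = g y" .
  have "smooth_lift p P"
    unfolding p_def[abs_def] P_def[abs_def] T_def
    by (intro smooth_lift_add smooth_lift_sum smooth_lift_scaleR smooth_lift_inner_scaleR[OF dims]
        smooth_lift_ident L[rule_format] fin)
  moreover have "absolutely_symmetric_on UNIV p"
    unfolding absolutely_symmetric_on_def
  proof (intro ballI allI impI)
    fix x and Q :: "(real, 'm, 'm) matrix" assume Q: "signed_permutation_matrix Q"
    have "T a b (Q *v x) = Q *v T a b x" for a b
      by (simp add: T_def odd_poly_signed_permutation[OF Q] inner_signed_permutation[OF Q] matrix_vector_mult_scaleR)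
    then show "p (Q *v x) = Q *v p x"
      by (simp add: p_def odd_poly_signed_permutation[OF Q] matrix_vector_right_distrib matrix_vector_mult_scaleR
        linear_sum[OF matrix_vector_mul_linear])
  qed
  moreover note py
  moreover have "(p has_derivative M) (at y)"
  proof -
    define B where "B b e = (\<Sum>j\<in>UNIV. (if t j = b then y $ j else 0) * e $ j)" for b and e :: "(real, 'm) vec"
    have T: "(T a b has_derivative (\<lambda>e. B b e *\<^sub>R odd_poly (q a) y)) (at y)" for a b
    proof -
      have "(\<chi> i. (poly (r b) ((y $ i)\<^sup>2) + 2 * (y $ i)\<^sup>2 * poly (pderiv (r b)) ((y $ i)\<^sup>2)) * e $ i) \<bullet> y = B b e"
        for e
        unfolding inner_vec_def B_def
        by (rule sum.cong) (auto simp: r simp flip: t_def, auto simp: t_def power2_eq_square)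
      then show ?thesis
        unfolding T_def
        using has_derivative_scaleR[OF has_derivative_inner[OF has_derivative_odd_poly[of "r b" y] has_derivative_ident]
            has_derivative_odd_poly[of "q a" y]]
        by (simp add: r0)
    qed
    have "(p has_derivative (\<lambda>e. (\<chi> i. (poly \<phi> ((y $ i)\<^sup>2) + 2 * (y $ i)\<^sup>2 * poly (pderiv \<phi>) ((y $ i)\<^sup>2)) * e $ i)
        + (\<Sum>a\<in>range t. \<Sum>b\<in>range t. \<alpha> (a, b) *\<^sub>R (B b e *\<^sub>R odd_poly (q a) y)))) (at y)"
      unfolding p_def[abs_def]
      by (intro has_derivative_add has_derivative_odd_poly has_derivative_sum has_derivative_scaleR_right T)
    moreover have "(\<chi> i. (poly \<phi> ((y $ i)\<^sup>2) + 2 * (y $ i)\<^sup>2 * poly (pderiv \<phi>) ((y $ i)\<^sup>2)) * e $ i)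
        + (\<Sum>a\<in>range t. \<Sum>b\<in>range t. \<alpha> (a, b) *\<^sub>R (B b e *\<^sub>R odd_poly (q a) y)) = M e" for e
    proof -
      have "(\<Sum>a\<in>range t. \<Sum>b\<in>range t. \<alpha> (a, b) *\<^sub>R (B b e *\<^sub>R odd_poly (q a) y)) $ i
          = (\<Sum>j\<in>UNIV. \<alpha> (t i, t j) * (y $ i * y $ j) * e $ j)" for i
      proof -
        have "(\<Sum>a\<in>range t. \<Sum>b\<in>range t. \<alpha> (a, b) *\<^sub>R (B b e *\<^sub>R odd_poly (q a) y)) $ i
            = (\<Sum>a\<in>range t. if a = t i then (\<Sum>b\<in>range t. \<alpha> (a, b) * B b e * y $ i) else 0)"
          unfolding sum_component
          by (rule sum.cong) (auto simp: odd_poly_def q sum_component mult_ac simp flip: t_def)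
        also have "\<dots> = (\<Sum>b\<in>range t. \<alpha> (t i, b) * B b e * y $ i)" by simp
        also have "\<dots> = (\<Sum>b\<in>range t. \<Sum>j\<in>UNIV. if b = t j then \<alpha> (t i, t j) * (y $ i * y $ j) * e $ j else 0)"
          unfolding B_def sum_distrib_left sum_distrib_right
          by (intro sum.cong refl) (auto simp: mult_ac)
        also have "\<dots> = (\<Sum>j\<in>UNIV. \<alpha> (t i, t j) * (y $ i * y $ j) * e $ j)"
          by (subst sum.swap) simp
        finally show ?thesis .
      qed
      moreover have "M e $ i = (v (t i) + 2 * t i * d (t i)) * e $ i + (\<Sum>j\<in>UNIV. \<alpha> (t i, t j) * (y $ i * y $ j) * e $ j)" for i
      proof -
        have "M e = matrix M *v e" using has_derivative_linear[OF M] by (simp add: matrix_works)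
        then have "M e $ i = (\<Sum>j\<in>UNIV. m i j * e $ j)"
          by (simp add: matrix_vector_mult_def m_def)
        also have "\<dots> = (\<Sum>j\<in>UNIV. (if j = i then (v (t i) + 2 * t i * d (t i)) * e $ i else 0)
            + \<alpha> (t i, t j) * (y $ i * y $ j) * e $ j)"
          using off_diagonal diagonal by (intro sum.cong refl) (auto simp: algebra_simps)
        also have "\<dots> = (v (t i) + 2 * t i * d (t i)) * e $ i + (\<Sum>j\<in>UNIV. \<alpha> (t i, t j) * (y $ i * y $ j) * e $ j)"
          by (simp add: sum.distrib)
        finally show ?thesis .
      qed
      ultimately show ?thesis
        using \<phi> by (simp add: vec_eq_iff flip: t_def)
    qed
    ultimately show ?thesis by simp
  qed
  ultimately show ?thesis by (intro exI[of _ p] exI[of _ P]) blast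
qed

section \<open>Spectral operators\<close>

lemma continuously_differentiable_at_diff:
  fixes f :: "'a::euclidean_space \<Rightarrow> 'b::real_normed_vector"
  assumes "continuously_differentiable_at f x" "continuously_differentiable_at g x"
  shows "continuously_differentiable_at (\<lambda>y. f y - g y) x"
  using continuously_differentiable_at_add[OF assms(1)
      continuously_differentiable_at_linear[OF bounded_linear_minus[OF bounded_linear_ident] assms(2)]]
  by simp

lemma derivative_norm_le_local_lipschitz:
  fixes f :: "'a::real_normed_vector \<Rightarrow> 'b::real_normed_vector"
  assumes f: "(f has_derivative f') (at x)" and A: "open A" "x \<in> A"
    and lip: "\<And>y. y \<in> A \<Longrightarrow> norm (f y - f x) \<le> K * norm (y - x)"
  shows "norm (f' e) \<le> K * norm e"
proof (cases "e = 0")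
  case True
  then show ?thesis using linear_0[OF has_derivative_linear[OF f]] by simp
next
  case False
  obtain r where r: "r > 0" "ball x r \<subseteq> A" using A openE by blast
  have lin: "linear f'" by (rule has_derivative_linear[OF f])
  have "norm (f' e) \<le> K * norm e + c" if "c > 0" for c
  proof -
    have "c / norm e > 0" using that False by simp
    then obtain d where d: "d > 0"
      "\<And>y. norm (y - x) < d \<Longrightarrow> norm (f y - f x - f' (y - x)) \<le> c / norm e * norm (y - x)"
      using f unfolding has_derivative_at_alt by meson
    define t where "t = min d r / (2 * norm e)"
    have t: "t > 0" using d(1) r(1) False by (simp add: t_def)
    have "t * norm e = min d r / 2" using False by (simp add: t_def)
    then have te: "t * norm e < d" "t * norm e < r" using d(1) r(1) by auto
    define y where "y = x + t *\<^sub>R e"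
    have y: "y - x = t *\<^sub>R e" "norm (y - x) = t * norm e" using t by (simp_all add: y_def)
    have "y \<in> A" using r(2) te(2) y(2) by (auto simp: dist_norm norm_minus_commute)
    have "t * norm (f' e) = norm (f' (y - x))"
      using t by (simp add: y(1) linear_cmul[OF lin])
    also have "\<dots> \<le> norm (f y - f x) + norm (f y - f x - f' (y - x))"
      using norm_triangle_ineq4[of "f y - f x" "f y - f x - f' (y - x)"] by simp
    also have "\<dots> \<le> K * (t * norm e) + c / norm e * (t * norm e)"
      using lip[OF \<open>y \<in> A\<close>] d(2)[of y] te(1) y(2) by simp
    also have "\<dots> = t * (K * norm e + c)" using False by (simp add: algebra_simps)
    finally show ?thesis using t by simp
  qed
  then show ?thesis by (rule field_le_epsilon)
qed

lemma continuously_differentiable_at_of_sv_matrix: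
  fixes U :: "('a::real_or_complex, 'm::{finite,linorder}, 'm) matrix" and V :: "('a, 'n::{finite,linorder}, 'n) matrix"
  assumes dims: "CARD('m) \<le> CARD('n)" and unitary: "unitary_matrix U" "unitary_matrix V"
    and G: "continuously_differentiable_at G (sv_matrix U V x)"
    and A: "open A" "x \<in> A" and eq: "\<And>y. y \<in> A \<Longrightarrow> G (sv_matrix U V y) = sv_matrix U V (g y)"
  shows "continuously_differentiable_at g x"
proof -
  let ?R = "adjoint (sv_matrix U V)"
  have R: "?R (sv_matrix U V y) = y" for y
  proof -
    have "\<forall>x. x \<bullet> ?R (sv_matrix U V y) = x \<bullet> y"
      using adjoint_works[OF linear_sv_matrix] inner_sv_matrix_same[OF dims unitary] by metis
    then show ?thesis by (rule vector_eq_ldot[THEN iffD1])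
  qed
  have "bounded_linear ?R"
    using adjoint_linear[OF linear_sv_matrix] by (simp add: linear_conv_bounded_linear)
  moreover have "continuously_differentiable_at (\<lambda>y. G (sv_matrix U V y)) x"
    by (rule continuously_differentiable_at_linear_arg[where L="sv_matrix U V", OF linear_sv_matrix[unfolded linear_conv_bounded_linear] G])
  ultimately have "continuously_differentiable_at (\<lambda>y. ?R (G (sv_matrix U V y))) x"
    by (rule continuously_differentiable_at_linear)
  then show ?thesis
    by (rule continuously_differentiable_at_cong[OF _ A]) (simp add: eq R)
qed

text \<open>
  There are only finitely many signed permutations, so the orbit of \<open>x\<close> is a discrete set.
\<close>

lemma exists_signed_permutation_gap:
  "\<exists>\<eta>>0. \<forall>Q. signed_permutation_matrix Q \<longrightarrow> Q *v x \<noteq> x \<longrightarrow> \<eta> \<le> norm (Q *v x - x)"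
proof -
  define A where "A = insert 1 ((\<lambda>Q. norm (Q *v x - x)) ` {Q. signed_permutation_matrix Q} - {0})"
  have fin: "finite A"
    unfolding A_def by (intro finite.insertI finite_Diff finite_imageI finite_signed_permutation_matrices)
  have "Min A \<in> A" by (rule Min_in[OF fin]) (simp add: A_def)
  then have "Min A > 0" by (auto simp: A_def)
  moreover have "Min A \<le> norm (Q *v x - x)" if "signed_permutation_matrix Q" "Q *v x \<noteq> x" for Q
    using that by (intro Min_le[OF fin]) (simp add: A_def)
  ultimately show ?thesis by blast
qed

text \<open>
  If \<open>Q\<close> fixes \<open>\<sigma>\<close>, then \<open>Q *v z\<close> stays in the ball around \<open>\<sigma>\<close>, where the mean value inequality
  applies.  Otherwise \<open>y\<close> and \<open>Q *v z\<close> are near different points of the orbit and at least \<open>2 * \<delta>\<close>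
  apart, while both values of \<open>h\<close> have norm at most \<open>\<epsilon> * \<delta>\<close> because \<open>h \<sigma> = 0\<close>.
\<close>

lemma equivariant_lipschitz_near_orbit:
  fixes h :: "real^'m \<Rightarrow> real^'m"
  assumes h: "absolutely_symmetric_on D h" and D: "ball \<sigma> r \<subseteq> D" and "r > 0" "\<epsilon> \<ge> 0"
    and h0: "h \<sigma> = 0"
    and deriv: "\<And>x. x \<in> ball \<sigma> r \<Longrightarrow> (h has_derivative h' x) (at x)"
    and bound: "\<And>x. x \<in> ball \<sigma> r \<Longrightarrow> onorm (h' x) \<le> \<epsilon>"
  shows "\<exists>\<delta>>0. \<forall>y\<in>ball \<sigma> \<delta>. \<forall>z\<in>ball \<sigma> \<delta>. \<forall>Q. signed_permutation_matrix Q \<longrightarrow>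
    norm (h y - Q *v h z) \<le> \<epsilon> * norm (y - Q *v z)"
proof -
  have sym: "h (Q *v x) = Q *v h x" if "x \<in> ball \<sigma> r" "signed_permutation_matrix Q" for Q x
    using h D that unfolding absolutely_symmetric_on_def by blast
  have lip: "norm (h y - h z) \<le> \<epsilon> * norm (y - z)" if "y \<in> ball \<sigma> r" "z \<in> ball \<sigma> r" for y z
    using differentiable_bound[OF convex_ball has_derivative_at_withinI[OF deriv] bound that] .
  obtain \<eta> where \<eta>: "\<eta> > 0" "\<forall>Q. signed_permutation_matrix Q \<longrightarrow> Q *v \<sigma> \<noteq> \<sigma> \<longrightarrow> \<eta> \<le> norm (Q *v \<sigma> - \<sigma>)"
    using exists_signed_permutation_gap by blast
  define \<delta> where "\<delta> = min r (\<eta> / 4)"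
  have \<delta>: "\<delta> > 0" "\<delta> \<le> r" "4 * \<delta> \<le> \<eta>" using \<open>r > 0\<close> \<eta>(1) by (auto simp: \<delta>_def)
  have "norm (h y - Q *v h z) \<le> \<epsilon> * norm (y - Q *v z)"
    if y: "y \<in> ball \<sigma> \<delta>" and z: "z \<in> ball \<sigma> \<delta>" and Q: "signed_permutation_matrix Q" for y z Q
  proof -
    have yz: "y \<in> ball \<sigma> r" "z \<in> ball \<sigma> r" using y z \<delta>(2) by auto
    have Qz: "norm (Q *v z - Q *v \<sigma>) < \<delta>"
      using z norm_signed_permutation_matrix_mult[OF Q, of "z - \<sigma>"]
      by (simp add: matrix_vector_mult_diff_distrib dist_norm norm_minus_commute)
    show ?thesis
    proof (cases "Q *v \<sigma> = \<sigma>")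
      case True
      then have "Q *v z \<in> ball \<sigma> r" using Qz \<delta>(2) by (simp add: dist_norm norm_minus_commute)
      then show ?thesis using lip[OF yz(1)] sym[OF yz(2) Q] by metis
    next
      case False
      have s: "\<sigma> \<in> ball \<sigma> r" using \<open>r > 0\<close> by simp
      have y\<sigma>: "norm (y - \<sigma>) < \<delta>" "norm (z - \<sigma>) < \<delta>" using y z by (simp_all add: dist_norm norm_minus_commute)
      have "norm (h y) \<le> \<epsilon> * \<delta>"
        using lip[OF yz(1) s] mult_left_mono[of "norm (y - \<sigma>)" \<delta> \<epsilon>] y\<sigma>(1) \<open>\<epsilon> \<ge> 0\<close> by (simp add: h0)
      moreover have "norm (h z) \<le> \<epsilon> * \<delta>"
        using lip[OF yz(2) s] mult_left_mono[of "norm (z - \<sigma>)" \<delta> \<epsilon>] y\<sigma>(2) \<open>\<epsilon> \<ge> 0\<close> by (simp add: h0)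
      ultimately have "norm (h y - Q *v h z) \<le> \<epsilon> * (2 * \<delta>)"
        using norm_triangle_ineq4[of "h y" "Q *v h z"] norm_signed_permutation_matrix_mult[OF Q, of "h z"] by simp
      also have "2 * \<delta> \<le> norm (y - Q *v z)"
      proof -
        have "4 * \<delta> \<le> norm (Q *v \<sigma> - \<sigma>)" using \<eta>(2) Q False \<delta>(3) by force
        also have "\<dots> \<le> norm (y - \<sigma>) + norm (y - Q *v z) + norm (Q *v z - Q *v \<sigma>)"
          by norm
        finally show ?thesis using y\<sigma>(1) Qz by simp
      qed
      then have "\<epsilon> * (2 * \<delta>) \<le> \<epsilon> * norm (y - Q *v z)" using \<open>\<epsilon> \<ge> 0\<close> by (rule mult_left_mono)
      finally show ?thesis .
    qed
  qed
  with \<delta>(1) show ?thesis by blast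
qed

text \<open>
  The vector \<open>s X\<close> may be any one that occurs in a decomposition of \<open>X\<close>; its coordinates may be negative
  and in any order.
\<close>

locale spectral_map =
  fixes N :: "('a::real_or_complex, 'm::{finite,linorder}, 'n::{finite,linorder}) matrix set"
    and D :: "(real, 'm) vec set" and g :: "(real, 'm) vec \<Rightarrow> (real, 'm) vec"
    and G :: "('a, 'm, 'n) matrix \<Rightarrow> ('a, 'm, 'n) matrix" and s :: "('a, 'm, 'n) matrix \<Rightarrow> (real, 'm) vec"
  assumes dims: "CARD('m) \<le> CARD('n)"
    and open_D: "open D" and g: "absolutely_symmetric_on D g" and open_N: "open N"
    and s_in_D: "X \<in> N \<Longrightarrow> s X \<in> D"
    and decomposition: "X \<in> N \<Longrightarrow> \<exists>U V. unitary_matrix U \<and> unitary_matrix V \<and>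
       X = sv_matrix U V (s X) \<and> G X = sv_matrix U V (g (s X))"
begin

lemma G_sv_matrix:
  assumes "unitary_matrix U" "unitary_matrix V" "sv_matrix U V x \<in> N"
  shows "G (sv_matrix U V x) = sv_matrix U V (g x)"
proof -
  define X where "X = sv_matrix U V x"
  obtain U' V' where *: "unitary_matrix U'" "unitary_matrix V'"
    "X = sv_matrix U' V' (s X)" "G X = sv_matrix U' V' (g (s X))"
    using decomposition[of X] assms(3) X_def by metis
  have "sv_matrix U V (g x) = sv_matrix U' V' (g (s X))"
    using assms(3) *(3) s_in_D by (intro sv_matrix_eqI[OF dims assms(1,2) *(1,2) g]) (simp_all add: X_def)
  then show ?thesis using *(4) by (simp add: X_def)
qed

lemma exists_signed_permutation_near:
  assumes "X \<in> N" "Y \<in> N"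
  shows "\<exists>Q. signed_permutation_matrix Q \<and> norm (s X - Q *v s Y) \<le> norm (X - Y)"
proof -
  obtain U V where X: "unitary_matrix U" "unitary_matrix V" "X = sv_matrix U V (s X)"
    using decomposition[OF assms(1)] by metis
  obtain U' V' where Y: "unitary_matrix U'" "unitary_matrix V'" "Y = sv_matrix U' V' (s Y)"
    using decomposition[OF assms(2)] by metis
  show ?thesis
    using exists_signed_permutation_norm_le_norm_diff_sv_matrix[OF dims X(1,2) Y(1,2), of "s X" "s Y"]
    unfolding X(3)[symmetric] Y(3)[symmetric] .
qed

lemma diff_smooth_lift:
  assumes P: "smooth_lift p P" and "X \<in> N" 
  shows "\<exists>U V. unitary_matrix U \<and> unitary_matrix V \<and> X = sv_matrix U V (s X) \<and>
    G X - P X = sv_matrix U V (g (s X) - p (s X))"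
proof -
  obtain U V where X: "unitary_matrix U" "unitary_matrix V" "X = sv_matrix U V (s X)" 
    "G X = sv_matrix U V (g (s X))"
    using decomposition[OF assms(2)] by metis
  have "P X = sv_matrix U V (p (s X))"
    using smooth_liftD(2)[OF P X(1,2), of "s X"] X(3) by simp
  with X show ?thesis by (intro exI[of _ U] exI[of _ V]) (simp add: linear_diff[OF linear_sv_matrix])
qed

lemma norm_diff_smooth_lift:
  "smooth_lift p P \<Longrightarrow> X \<in> N \<Longrightarrow> norm (G X - P X) = norm (g (s X) - p (s X))"
  using diff_smooth_lift norm_sv_matrix[OF dims] by metis

text \<open>
  The norm of \<open>G Y - P Y\<close> is that of \<open>g - p\<close> at \<open>s Y\<close>, hence also at \<open>Q *v s Y\<close> for each \<open>Q\<close>.  One of these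
  points is at distance at most \<open>norm (Y - X)\<close> from \<open>s X\<close>, where \<open>g - p\<close> vanishes to first order.
\<close>

lemma diff_smooth_lift_has_derivative_zero:
  assumes P: "smooth_lift p P" and p: "absolutely_symmetric_on UNIV p" and X: "X \<in> N"
    and jet: "p (s X) = g (s X)" "(p has_derivative M) (at (s X))" "(g has_derivative M) (at (s X))"
  shows "((\<lambda>Y. G Y - P Y) has_derivative (\<lambda>_. 0)) (at X)"
  unfolding has_derivative_at_alt
proof (intro conjI allI impI bounded_linear_zero)
  fix e :: real assume "e > 0"
  define h where "h x = g x - p x" for x
  have sym: "h (Q *v x) = Q *v h x" if "x \<in> D" "signed_permutation_matrix Q" for x Q
    using g p that by (simp add: h_def absolutely_symmetric_on_def matrix_vector_mult_diff_distrib)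
  have "(h has_derivative (\<lambda>_. 0)) (at (s X))"
    using has_derivative_diff[OF jet(3,2)] by (simp add: h_def[abs_def])
  then obtain d where d: "d > 0" "\<And>x. norm (x - s X) < d \<Longrightarrow> norm (h x - h (s X) - 0) \<le> e * norm (x - s X)"
    using \<open>e > 0\<close> unfolding has_derivative_at_alt by meson
  have h0: "h (s X) = 0" by (simp add: h_def jet(1))
  obtain r where r: "r > 0" "ball X r \<subseteq> N" using open_N X openE by blast
  have "norm (G Y - P Y - (G X - P X) - 0) \<le> e * norm (Y - X)" if Y: "norm (Y - X) < min d r" for Y
  proof -
    have "Y \<in> N" using Y r(2) by (auto simp: dist_norm norm_minus_commute)
    obtain Q where Q: "signed_permutation_matrix Q" "norm (s X - Q *v s Y) \<le> norm (X - Y)"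
      using exists_signed_permutation_near[OF X \<open>Y \<in> N\<close>] by blast
    then have near: "norm (Q *v s Y - s X) \<le> norm (Y - X)" by (simp add: norm_minus_commute)
    have "G X - P X = 0" using norm_diff_smooth_lift[OF P X] jet(1) by simp
    then have "norm (G Y - P Y - (G X - P X) - 0) = norm (h (s Y))"
      by (simp add: norm_diff_smooth_lift[OF P \<open>Y \<in> N\<close>] h_def)
    also have "\<dots> = norm (h (Q *v s Y))"
      by (simp add: sym[OF s_in_D[OF \<open>Y \<in> N\<close>] Q(1)] norm_signed_permutation_matrix_mult[OF Q(1)])
    also have "\<dots> \<le> e * norm (Q *v s Y - s X)"
      using d(2)[of "Q *v s Y"] near Y h0 by simp
    also have "\<dots> \<le> e * norm (Y - X)" using near \<open>e > 0\<close> by simp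
    finally show ?thesis .
  qed
  then show "\<exists>d>0. \<forall>Y. norm (Y - X) < d \<longrightarrow> norm (G Y - P Y - (G X - P X) - 0) \<le> e * norm (Y - X)"
    using d(1) r(1) by (intro exI[of _ "min d r"]) simp
qed

lemma differentiable_at_if:
  assumes X: "X \<in> N" and "g differentiable (at (s X))"
  shows "G differentiable (at X)"
proof -
  obtain M where M: "(g has_derivative M) (at (s X))"
    using assms(2) unfolding differentiable_def by blast
  obtain p and P :: "('a, 'm, 'n) matrix \<Rightarrow> ('a, 'm, 'n) matrix" where P: "smooth_lift p P"
    "absolutely_symmetric_on UNIV p" "p (s X) = g (s X)" "(p has_derivative M) (at (s X))"
    using exists_smooth_lift_jet[OF dims g open_D s_in_D[OF X] M] by metis
  have "((\<lambda>Y. G Y - P Y) has_derivative (\<lambda>_. 0)) (at X)"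
    by (rule diff_smooth_lift_has_derivative_zero[OF P(1,2) X P(3,4) M])
  moreover obtain P' where "(P has_derivative P') (at X)"
    using smooth_liftD(1)[OF P(1), of X] unfolding continuously_differentiable_at_def by metis
  ultimately have "((\<lambda>Y. (G Y - P Y) + P Y) has_derivative (\<lambda>e. 0 + P' e)) (at X)"
    by (rule has_derivative_add)
  then show ?thesis unfolding differentiable_def by auto
qed

text \<open>
  For \<open>Y\<close> near \<open>X\<close> some \<open>Q *v s Y\<close> is near \<open>s X\<close>, and differentiability of \<open>g\<close> is carried back from there
  to \<open>s Y\<close> by equivariance.
\<close>

lemma differentiable_near:
  assumes X: "X \<in> N" and r: "\<And>x. x \<in> ball (s X) r \<Longrightarrow> g differentiable (at x)"
    and Y: "Y \<in> N" "Y \<in> ball X r"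
  shows "G differentiable (at Y)"
proof (rule differentiable_at_if[OF Y(1)])
  obtain Q where Q: "signed_permutation_matrix Q" "norm (s X - Q *v s Y) \<le> norm (X - Y)"
    using exists_signed_permutation_near[OF X Y(1)] by blast
  obtain R where R: "R ** Q = mat 1"
    using signed_permutation_matrix_inverse[OF Q(1)] by metis
  have "Q *v s Y \<in> ball (s X) r" using Q(2) Y(2) by (simp add: dist_norm)
  then obtain F where F: "(g has_derivative F) (at (Q *v s Y))"
    using r unfolding differentiable_def by blast
  have L: "((*v) Q has_derivative (*v) Q) (at (s Y))"
    by (rule bounded_linear_imp_has_derivative[OF matrix_vector_mul_bounded_linear])
  have "((\<lambda>x. R *v g (Q *v x)) has_derivative (\<lambda>e. R *v F (Q *v e))) (at (s Y))"
    by (rule bounded_linear.has_derivative[OF matrix_vector_mul_bounded_linear has_derivative_compose[OF L F]])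
  then have "(g has_derivative (\<lambda>e. R *v F (Q *v e))) (at (s Y))"
  proof (rule has_derivative_transform_within_open[OF _ open_D s_in_D[OF Y(1)]])
    fix x assume "x \<in> D"
    then have "g (Q *v x) = Q *v g x"
      using g Q(1) unfolding absolutely_symmetric_on_def by blast
    then show "R *v g (Q *v x) = g x" by (simp add: matrix_vector_mul_assoc R)
  qed
  then show "g differentiable (at (s Y))" unfolding differentiable_def by blast
qed

text \<open>
  Choose \<open>Q1\<close> and \<open>Q2\<close> that bring \<open>s Y\<close> and \<open>s Z\<close> close to \<open>s X\<close>.  Composing an arbitrary \<open>Q\<close> with them
  turns the estimate near the orbit into the hypothesis of the comparison principle for \<open>s Y\<close> and
  \<open>s Z\<close>.
\<close>

lemma diff_smooth_lift_lipschitz_near: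
  assumes P: "smooth_lift p P" and p: "absolutely_symmetric_on UNIV p" and X: "X \<in> N"
    and r: "r > 0" "ball (s X) r \<subseteq> D" and "\<epsilon> \<ge> 0"
    and h0: "p (s X) = g (s X)"
    and deriv: "\<And>x. x \<in> ball (s X) r \<Longrightarrow> ((\<lambda>x. g x - p x) has_derivative h' x) (at x)"
    and bound: "\<And>x. x \<in> ball (s X) r \<Longrightarrow> onorm (h' x) \<le> \<epsilon>"
  shows "\<exists>\<delta>>0. ball X \<delta> \<subseteq> N \<and> (\<forall>Y\<in>ball X \<delta>. \<forall>Z\<in>ball X \<delta>.
    norm ((G Y - P Y) - (G Z - P Z)) \<le> \<epsilon> * norm (Y - Z))"
proof -
  define h where "h x = g x - p x" for x
  have hD: "absolutely_symmetric_on D h"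
    using g p by (simp add: h_def absolutely_symmetric_on_def matrix_vector_mult_diff_distrib)
  have sym: "h (Q *v x) = Q *v h x" if "x \<in> D" "signed_permutation_matrix Q" for x Q
    using hD that unfolding absolutely_symmetric_on_def by blast
  obtain d where d: "d > 0" "\<forall>y\<in>ball (s X) d. \<forall>z\<in>ball (s X) d. \<forall>Q. signed_permutation_matrix Q \<longrightarrow>
      norm (h y - Q *v h z) \<le> \<epsilon> * norm (y - Q *v z)"
    using equivariant_lipschitz_near_orbit[OF hD r(2,1) \<open>\<epsilon> \<ge> 0\<close> _ deriv[folded h_def[abs_def]] bound] h0
    by (auto simp: h_def)
  obtain r' where r': "r' > 0" "ball X r' \<subseteq> N" using open_N X openE by blast
  define \<delta> where "\<delta> = min d r'"
  have \<delta>: "\<delta> > 0" "\<delta> \<le> d" "\<delta> \<le> r'" using d(1) r'(1) by (auto simp: \<delta>_def)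
  have "norm ((G Y - P Y) - (G Z - P Z)) \<le> \<epsilon> * norm (Y - Z)" if Y: "Y \<in> ball X \<delta>" and Z: "Z \<in> ball X \<delta>" for Y Z
  proof -
    have N: "Y \<in> N" "Z \<in> N" using Y Z r'(2) \<delta>(3) by auto
    obtain Q1 where Q1: "signed_permutation_matrix Q1" "norm (s X - Q1 *v s Y) \<le> norm (X - Y)"
      using exists_signed_permutation_near[OF X N(1)] by blast
    obtain Q2 where Q2: "signed_permutation_matrix Q2" "norm (s X - Q2 *v s Z) \<le> norm (X - Z)"
      using exists_signed_permutation_near[OF X N(2)] by blast
    obtain R2 where R2: "signed_permutation_matrix R2" "R2 ** Q2 = mat 1"
      using signed_permutation_matrix_inverse[OF Q2(1)] by metis
    have b: "Q1 *v s Y \<in> ball (s X) d" "Q2 *v s Z \<in> ball (s X) d"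
      using Q1(2) Q2(2) Y Z \<delta>(2) by (simp_all add: dist_norm)
    have le: "norm (h (s Y) - Q *v h (s Z)) \<le> \<epsilon> * norm (s Y - Q *v s Z)" if Q: "signed_permutation_matrix Q" for Q
    proof -
      define K where "K = Q1 ** Q ** R2"
      have K: "signed_permutation_matrix K"
        unfolding K_def by (intro signed_permutation_matrix_mult Q1 Q R2)
      have KQ2: "K *v (Q2 *v x) = Q1 *v (Q *v x)" for x
        using R2(2) by (simp add: K_def matrix_vector_mul_assoc flip: matrix_mul_assoc)
      have "norm (h (Q1 *v s Y) - K *v h (Q2 *v s Z)) \<le> \<epsilon> * norm (Q1 *v s Y - K *v (Q2 *v s Z))"
        using d(2) b K by blast
      also have "h (Q1 *v s Y) - K *v h (Q2 *v s Z) = Q1 *v (h (s Y) - Q *v h (s Z))"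
        by (simp only: sym[OF s_in_D[OF N(1)] Q1(1)] sym[OF s_in_D[OF N(2)] Q2(1)] KQ2 matrix_vector_mult_diff_distrib)
      also have "Q1 *v s Y - K *v (Q2 *v s Z) = Q1 *v (s Y - Q *v s Z)"
        by (simp only: KQ2 matrix_vector_mult_diff_distrib)
      finally show ?thesis by (simp only: norm_signed_permutation_matrix_mult[OF Q1(1)])
    qed
    obtain U V where UV: "unitary_matrix U" "unitary_matrix V" "Y = sv_matrix U V (s Y)"
      "G Y - P Y = sv_matrix U V (h (s Y))"
      using diff_smooth_lift[OF P N(1)] unfolding h_def by metis
    obtain U' V' where UV': "unitary_matrix U'" "unitary_matrix V'" "Z = sv_matrix U' V' (s Z)"
      "G Z - P Z = sv_matrix U' V' (h (s Z))"
      using diff_smooth_lift[OF P N(2)] unfolding h_def by metis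
    have "norm (sv_matrix U V (h (s Y)) - sv_matrix U' V' (h (s Z)))
        \<le> \<epsilon> * norm (sv_matrix U V (s Y) - sv_matrix U' V' (s Z))"
      by (rule norm_diff_sv_matrix_le[OF dims UV(1,2) UV'(1,2) le \<open>\<epsilon> \<ge> 0\<close>])
    then show ?thesis
      unfolding UV(4) UV'(4) UV(3)[symmetric] UV'(3)[symmetric] .
  qed
  moreover have "ball X \<delta> \<subseteq> N" using r'(2) \<delta>(3) by auto
  ultimately show ?thesis using \<delta>(1) by blast
qed

text \<open>
  Restriction of \<open>G\<close> to the slice of matrices with the unitary factors of \<open>X\<close>.
\<close>

lemma continuously_differentiable_at_vector:
  assumes X: "X \<in> N" and G: "continuously_differentiable_at G X"
  shows "continuously_differentiable_at g (s X)"
proof -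
  obtain U V where UV: "unitary_matrix U" "unitary_matrix V" "X = sv_matrix U V (s X)"
    using decomposition[OF X] by metis
  show ?thesis
  proof (rule continuously_differentiable_at_of_sv_matrix[OF dims UV(1,2)])
    show "continuously_differentiable_at G (sv_matrix U V (s X))" using G UV(3) by simp
    show "open (sv_matrix U V -` N)"
      using open_N linear_continuous_at[OF linear_sv_matrix[unfolded linear_conv_bounded_linear]]
      by (intro continuous_open_vimage)
    show "s X \<in> sv_matrix U V -` N" using X UV(3) by simp
    show "G (sv_matrix U V y) = sv_matrix U V (g y)" if "y \<in> sv_matrix U V -` N" for y
      using G_sv_matrix[OF UV(1,2)] that by simp
  qed
qed

text \<open>
  \<open>G\<close> is split as \<open>H + P\<close>, where \<open>P\<close> carries the value and derivative of \<open>g\<close> at \<open>s X\<close>.  The derivative of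
  \<open>H\<close> exists near \<open>X\<close>, is zero at \<open>X\<close>, and is bounded by the local Lipschitz constants of \<open>H\<close>, which are
  as small as the derivative of \<open>g - p\<close> near \<open>s X\<close>.
\<close>

lemma continuously_differentiable_at_matrix:
  assumes X: "X \<in> N" and C1: "continuously_differentiable_at g (s X)"
  shows "continuously_differentiable_at G X"
proof -
  obtain W g' where W: "open W" "s X \<in> W" "\<forall>x\<in>W. (g has_derivative blinfun_apply (g' x)) (at x)"
    using C1 unfolding continuously_differentiable_at_def by metis
  have M: "(g has_derivative blinfun_apply (g' (s X))) (at (s X))" using W by blast
  obtain p and P :: "('a, 'm, 'n) matrix \<Rightarrow> ('a, 'm, 'n) matrix" where P: "smooth_lift p P"
    "absolutely_symmetric_on UNIV p" "p (s X) = g (s X)" "(p has_derivative blinfun_apply (g' (s X))) (at (s X))"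
    using exists_smooth_lift_jet[OF dims g open_D s_in_D[OF X] M] by metis
  obtain U V where UV: "unitary_matrix U" "unitary_matrix V" "X = sv_matrix U V (s X)"
    using decomposition[OF X] by metis
  have "continuously_differentiable_at p (s X)"
    by (rule continuously_differentiable_at_of_sv_matrix[OF dims UV(1,2) smooth_liftD(1)[OF P(1)] open_UNIV UNIV_I
          smooth_liftD(2)[OF P(1) UV(1,2)]])
  then have "continuously_differentiable_at (\<lambda>x. g x - p x) (s X)"
    by (rule continuously_differentiable_at_diff[OF C1])
  then obtain W' h' where W': "open W'" "s X \<in> W'" "isCont h' (s X)"
    "\<forall>x\<in>W'. ((\<lambda>x. g x - p x) has_derivative blinfun_apply (h' x)) (at x)"
    unfolding continuously_differentiable_at_def by metis
  have "((\<lambda>x. g x - p x) has_derivative (\<lambda>_. 0)) (at (s X))"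
    using has_derivative_diff[OF M P(4)] by simp
  then have "blinfun_apply (h' (s X)) = (\<lambda>_. 0)"
    using W'(2,4) has_derivative_unique by blast
  then have h'0: "h' (s X) = 0" by (intro blinfun_eqI) simp
  define H where "H Y = G Y - P Y" for Y
  obtain r where r: "r > 0" "ball (s X) r \<subseteq> W" using W(1,2) openE by blast
  define A where "A = ball X r \<inter> N"
  have A: "open A" "X \<in> A" "A \<subseteq> N" using open_N X r(1) by (auto simp: A_def)
  have "\<exists>H'. (H has_derivative H') (at Y)" if "Y \<in> A" for Y
  proof -
    have "g differentiable (at x)" if "x \<in> ball (s X) r" for x
      using W(3) r(2) that unfolding differentiable_def by blast
    then have "G differentiable (at Y)"
      using \<open>Y \<in> A\<close> by (intro differentiable_near[OF X, of r]) (auto simp: A_def)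
    moreover have "P differentiable (at Y)"
      using smooth_liftD(1)[OF P(1), of Y] unfolding continuously_differentiable_at_def differentiable_def by metis
    ultimately show ?thesis
      unfolding H_def[abs_def] using differentiable_diff differentiable_def by metis
  qed
  then obtain H' where H': "\<And>Y. Y \<in> A \<Longrightarrow> (H has_derivative H' Y) (at Y)" by metis
  have H'X: "H' X = (\<lambda>_. 0)"
    using has_derivative_unique[OF H'[OF A(2)]]
      diff_smooth_lift_has_derivative_zero[OF P(1,2) X P(3,4) M] by (simp add: H_def[abs_def])
  have small: "\<exists>\<delta>>0. \<forall>Y\<in>ball X \<delta>. norm (H' Y e) \<le> \<epsilon> * norm e" if "\<epsilon> > 0" for \<epsilon> e
  proof -
    obtain d where d: "d > 0" "\<forall>x. dist x (s X) < d \<longrightarrow> dist (h' x) (h' (s X)) < \<epsilon>"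
      using W'(3) \<open>\<epsilon> > 0\<close> unfolding continuous_at_eps_delta by blast
    have "open (W' \<inter> D \<inter> ball (s X) d)" using W'(1) open_D by blast
    moreover have "s X \<in> W' \<inter> D \<inter> ball (s X) d" using W'(2) s_in_D[OF X] d(1) by simp
    ultimately obtain r' where r': "r' > 0" "ball (s X) r' \<subseteq> W' \<inter> D \<inter> ball (s X) d"
      by (rule openE)
    have "\<exists>\<delta>>0. ball X \<delta> \<subseteq> N \<and> (\<forall>Y\<in>ball X \<delta>. \<forall>Z\<in>ball X \<delta>.
        norm ((G Y - P Y) - (G Z - P Z)) \<le> \<epsilon> * norm (Y - Z))"
    proof (rule diff_smooth_lift_lipschitz_near[OF P(1,2) X r'(1) _ less_imp_le[OF \<open>\<epsilon> > 0\<close>] P(3)])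
      show "ball (s X) r' \<subseteq> D" using r'(2) by blast
      show "((\<lambda>x. g x - p x) has_derivative blinfun_apply (h' x)) (at x)" if "x \<in> ball (s X) r'" for x
        using W'(4) r'(2) that by blast
      show "onorm (blinfun_apply (h' x)) \<le> \<epsilon>" if "x \<in> ball (s X) r'" for x
      proof -
        have "dist x (s X) < d" using r'(2) that by (auto simp: dist_commute)
        then have "norm (h' x) < \<epsilon>" using d(2) h'0 by (auto simp: dist_norm)
        then show ?thesis by (simp add: norm_blinfun.rep_eq)
      qed
    qed
    then obtain \<delta> where \<delta>: "\<delta> > 0" "\<forall>Y\<in>ball X \<delta>. \<forall>Z\<in>ball X \<delta>.
        norm ((G Y - P Y) - (G Z - P Z)) \<le> \<epsilon> * norm (Y - Z)"
      by (elim exE conjE) (rule that)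
    have "norm (H' Y e) \<le> \<epsilon> * norm e" if "Y \<in> ball X \<delta> \<inter> A" for Y
    proof (rule derivative_norm_le_local_lipschitz[of H _ Y "ball X \<delta>"])
      show "(H has_derivative H' Y) (at Y)" using H' that by blast
      show "Y \<in> ball X \<delta>" using that by blast
      show "norm (H Z - H Y) \<le> \<epsilon> * norm (Z - Y)" if "Z \<in> ball X \<delta>" for Z
        using \<delta>(2) that \<open>Y \<in> ball X \<delta>\<close> unfolding H_def by blast
    qed simp
    moreover obtain \<delta>' where "\<delta>' > 0" "ball X \<delta>' \<subseteq> A" using A(1,2) openE by blast
    ultimately show ?thesis
      using \<delta>(1) by (intro exI[of _ "min \<delta> \<delta>'"]) auto
  qed
  have "isCont (\<lambda>Y. H' Y e) X" for e
    unfolding continuous_at_eps_delta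
  proof (intro allI impI)
    fix \<epsilon> :: real assume "\<epsilon> > 0"
    then have "\<epsilon> / (norm e + 1) > 0" by (simp add: add_nonneg_pos)
    from small[OF this, of e] obtain \<delta> where \<delta>: "\<delta> > 0" "\<forall>Y\<in>ball X \<delta>. norm (H' Y e) \<le> \<epsilon> / (norm e + 1) * norm e"
      by blast
    have "\<epsilon> / (norm e + 1) * norm e < \<epsilon>"
      using \<open>\<epsilon> > 0\<close> by (simp add: divide_less_eq add_nonneg_pos)
    with \<delta> show "\<exists>d>0. \<forall>Y. dist Y X < d \<longrightarrow> dist (H' Y e) (H' X e) < \<epsilon>"
      by (intro exI[of _ \<delta>]) (auto simp: H'X dist_commute intro: le_less_trans)
  qed
  then have "continuously_differentiable_at H X"
    unfolding continuously_differentiable_at_iff using A(1,2) H'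
    by (intro exI[of _ A] exI[of _ H']) simp
  from continuously_differentiable_at_add[OF this smooth_liftD(1)[OF P(1)]]
  show ?thesis by (simp add: H_def)
qed

end

lemma spectral_map_singular_values:
  fixes N :: "('a::real_or_complex, 'm::{finite,linorder}, 'n::{finite,linorder}) matrix set"
  assumes "CARD('m) \<le> CARD('n)" "open D" "absolutely_symmetric_on D g"
    "open N" "singular_values ` N \<subseteq> D" "spectral_operator_on N g G"
  shows "spectral_map N D g G singular_values"
proof
  fix X assume "X \<in> N"
  then show "singular_values X \<in> D" using assms(5) by blast
  obtain U V where "(U, V) \<in> svd_pairs X" "G X = U ** diag_zero (g (singular_values X)) ** adjoint_matrix V"
    using assms(6) \<open>X \<in> N\<close> unfolding spectral_operator_on_def by blast
  then show "\<exists>U V. unitary_matrix U \<and> unitary_matrix V \<and>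
       X = sv_matrix U V (singular_values X) \<and> G X = sv_matrix U V (g (singular_values X))"
    unfolding svd_pairs_def sv_matrix_def by blast
qed (use assms in auto)

lemma spectral_operator_continuously_differentiable_iff:
  fixes N :: "('a::real_or_complex, 'm::{finite,linorder}, 'n::{finite,linorder}) matrix set"
  assumes "CARD('m) \<le> CARD('n)" "open D" "absolutely_symmetric_on D g"
    "open N" "singular_values ` N \<subseteq> D" "spectral_operator_on N g G" "X \<in> N"
  shows "continuously_differentiable_at G X \<longleftrightarrow> continuously_differentiable_at g (singular_values X)"
  using spectral_map.continuously_differentiable_at_vector[OF spectral_map_singular_values[OF assms(1-6)] assms(7)]
    spectral_map.continuously_differentiable_at_matrix[OF spectral_map_singular_values[OF assms(1-6)] assms(7)]
  by metis

theorem theorem3p4: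
  fixes g :: "(real, 'm::{finite,linorder}) vec \<Rightarrow> (real, 'm) vec"
    and D :: "(real, 'm) vec set"
  assumes "CARD('m) \<le> CARD('n::{finite,linorder})"
    and "open D"
    and "absolutely_symmetric_on D g"
  shows "(\<forall>(N :: (real, 'm, 'n) matrix set) G X.
            N \<noteq> {} \<and> open N \<and> singular_values ` N \<subseteq> D \<and> spectral_operator_on N g G \<and> X \<in> N \<longrightarrow>
            (continuously_differentiable_at G X \<longleftrightarrow>
             continuously_differentiable_at g (singular_values X)))
       \<and> (\<forall>(N :: (complex, 'm, 'n) matrix set) G X.
            N \<noteq> {} \<and> open N \<and> singular_values ` N \<subseteq> D \<and> spectral_operator_on N g G \<and> X \<in> N \<longrightarrow>
            (continuously_differentiable_at G X \<longleftrightarrow>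
             continuously_differentiable_at g (singular_values X)))"
  by (intro conjI allI impI; elim conjE; rule spectral_operator_continuously_differentiable_iff[OF assms])

end
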